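(* Assume that the non-degenerate source condition (NDSC) holds and that $\Phi$ is injective on $\mathcal{C}=\prod_{1\le i\le N}\{\alpha_i\,u_i\otimes v_i:\alpha_i\ge 0\}$. Then $F^\dagger=(\sigma_i u_i\otimes v_i)_{1\le i\le N}$ is the unique solution to $$\min_{F\in\mathcal{B}_2(\mathcal{H}_1;\mathcal{H}_2)^N}\ \sum_{i=1}^N\|F_i\|_*\quad\text{subject to}\quad \Phi F=z .$$
   Context: $\mathcal{H}_1,\mathcal{H}_2,\mathcal{H}$ are real separable Hilbert spaces. $\mathcal{B}_2(\mathcal{H}_1;\mathcal{H}_2)$ is the Hilbert space of Hilbert–Schmidt operators from $\mathcal{H}_1$ to $\mathcal{H}_2$, with inner product $\langle G,H\rangle=\sum_k\langle Ge_k,He_k\rangle_{\mathcal{H}_2}$ ($\{e_k\}$ an orthonormal basis of $\mathcal{H}_1$) and norm $\|\cdot\|_{\mathrm{HS}}$. For $G\in\mathcal{B}_2(\mathcal{H}_1;\mathcal{H}_2)$, $\|G\|_*\in[0,+\infty]$ is the nuclear norm (sum of the singular values) and $\|G\|$ is the operator norm. For $u\in\mathcal{H}_1$, $v\in\mathcal{H}_2$, $u\otimes v$ denotes the operator $a\mapsto\langle u,a\rangle_{\mathcal{H}_1}v$. $N\ge 1$ is an integer. For $1\le i\le N$, $u_i\in\mathcal{H}_1$ and $v_i\in\mathcal{H}_2$ are unit vectors and $\sigma_i>0$; $F^\dagger=(F_i^\dagger)_{1\le i\le N}=(\sigma_iu_i\otimes v_i)_{1\le i\le N}$. $\Phi:\mathcal{B}_2(\mathcal{H}_1;\mathcal{H}_2)^N\to\mathcal{H}$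 is a bounded linear operator with adjoint $\Phi^*$, and $z=\Phi F^\dagger$. (NDSC): there exists $H=(H_i)_{1\le i\le N}\in\mathrm{Im}(\Phi^* )$ such that for every $1\le i\le N$, $H_i=u_i\otimes v_i+W_i$ with $W_iu_i=0$, $W_i^*v_i=0$ and $\|W_i\|<1$. *)

theory Defs
  imports "HOL-Analysis.Analysis"
begin

definition orthonormal_basis :: "'a::real_inner set \<Rightarrow> bool" where
  "orthonormal_basis B \<longleftrightarrow>
     pairwise orthogonal B \<and> (\<forall>e\<in>B. norm e = 1) \<and> closure (span B) = UNIV"

lemma bessel_finite:
  fixes u :: "'a::real_inner"
  assumes "finite C" "pairwise orthogonal C" "\<forall>e\<in>C. norm e = 1"
  shows "(\<Sum>e\<in>C. (u \<bullet> e)\<^sup>2) \<le> (norm u)\<^sup>2"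
proof -
  let ?p = "\<Sum>e\<in>C. (u \<bullet> e) *\<^sub>R e"
  have pe: "?p \<bullet> e = u \<bullet> e" if "e \<in> C" for e
  proof -
    have "?p \<bullet> e = (\<Sum>e'\<in>C. (u \<bullet> e') * (e' \<bullet> e))"
      by (simp add: inner_sum_left)
    also have "\<dots> = (\<Sum>e'\<in>C. if e' = e then u \<bullet> e else 0)"
      using assms that
      by (intro sum.cong) (auto simp: pairwise_def orthogonal_def norm_eq_1)
    finally show ?thesis using assms(1) that by simp
  qed
  have pp: "?p \<bullet> ?p = (\<Sum>e\<in>C. (u \<bullet> e)\<^sup>2)"
    by (subst inner_sum_right) (auto simp: pe power2_eq_square intro!: sum.cong)
  have up: "u \<bullet> ?p = (\<Sum>e\<in>C. (u \<bullet> e)\<^sup>2)"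
    by (simp add: inner_sum_right power2_eq_square)
  have "0 \<le> (u - ?p) \<bullet> (u - ?p)" by simp
  also have "\<dots> = u \<bullet> u - (\<Sum>e\<in>C. (u \<bullet> e)\<^sup>2)"
    using pp up by (simp add: inner_diff_left inner_diff_right inner_commute)
  finally show ?thesis by (simp add: dot_square_norm)
qed

lemma gram_schmidt_insert:
  fixes x :: "'a::real_inner"
  assumes "finite C" "pairwise orthogonal C" "\<forall>e\<in>C. norm e = 1"
  shows "\<exists>D. finite D \<and> pairwise orthogonal D \<and> (\<forall>e\<in>D. norm e = 1) \<and> C \<subseteq> D \<and> x \<in> span D"
proof -
  let ?p = "\<Sum>e\<in>C. (x \<bullet> e) *\<^sub>R e"
  define y where "y = x - ?p"
  have pe: "?p \<bullet> e = x \<bullet> e" if "e \<in> C" for e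
  proof -
    have "?p \<bullet> e = (\<Sum>e'\<in>C. (x \<bullet> e') * (e' \<bullet> e))"
      by (simp add: inner_sum_left)
    also have "\<dots> = (\<Sum>e'\<in>C. if e' = e then x \<bullet> e else 0)"
      using assms that
      by (intro sum.cong) (auto simp: pairwise_def orthogonal_def norm_eq_1)
    finally show ?thesis using assms(1) that by simp
  qed
  have ye: "y \<bullet> e = 0" if "e \<in> C" for e
    using pe[OF that] by (simp add: y_def inner_diff_left)
  have p_span: "?p \<in> span C"
    by (intro span_sum span_scale span_base)
  have x: "x = y + ?p" by (simp add: y_def)
  show ?thesis
  proof (cases "y = 0")
    case True
    then show ?thesis using assms p_span x by (intro exI[of _ C]) auto
  next
    case False
    let ?n = "(1 / norm y) *\<^sub>R y"
    have "?p \<in> span (insert ?n C)"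
      using p_span span_mono[of C "insert ?n C"] by blast
    moreover have "norm y *\<^sub>R ?n \<in> span (insert ?n C)"
      by (rule span_scale, rule span_base) simp
    ultimately have "norm y *\<^sub>R ?n + ?p \<in> span (insert ?n C)"
      by (rule span_add[rotated])
    then have "x \<in> span (insert ?n C)" using False x by simp
    moreover have "pairwise orthogonal (insert ?n C)"
      using assms(2) ye
      by (auto simp: pairwise_insert orthogonal_def inner_commute)
    ultimately show ?thesis
      using assms False by (intro exI[of _ "insert ?n C"]) auto
  qed
qed

lemma orthonormal_basis_exists:
  "\<exists>B :: 'a::{real_inner,second_countable_topology} set. orthonormal_basis B"
proof -
  obtain D :: "'a set" where D: "countable D"
    "\<And>X. open X \<Longrightarrow> X \<noteq> {} \<Longrightarrow> \<exists>d\<in>D. d \<in> X"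
    using countable_dense_exists by metis
  have D_ne: "D \<noteq> {}" using D(2)[of UNIV] by auto
  let ?P = "\<lambda>C :: 'a set. finite C \<and> pairwise orthogonal C \<and> (\<forall>e\<in>C. norm e = 1)"
  have "\<exists>f. \<forall>n. ?P (f n) \<and> (f n \<subseteq> f (Suc n) \<and> from_nat_into D n \<in> span (f (Suc n)))"
  proof (rule dependent_nat_choice[where P = "\<lambda>_ C. ?P C"
        and Q = "\<lambda>n C C'. C \<subseteq> C' \<and> from_nat_into D n \<in> span C'"])
    show "\<exists>C. ?P C" by (rule exI[of _ "{}"]) simp
    show "\<exists>C'. ?P C' \<and> (C \<subseteq> C' \<and> from_nat_into D n \<in> span C')" if "?P C" for C n
      using gram_schmidt_insert[of C "from_nat_into D n"] that by auto
  qed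
  then obtain f where f: "\<And>n. ?P (f n)" "\<And>n. f n \<subseteq> f (Suc n)"
    "\<And>n. from_nat_into D n \<in> span (f (Suc n))" by auto
  have mono: "f m \<subseteq> f n" if "m \<le> n" for m n
    using lift_Suc_mono_le[of f, OF f(2) that] .
  let ?B = "\<Union>n. f n"
  have "orthogonal x y" if xy: "x \<in> ?B" "y \<in> ?B" "x \<noteq> y" for x y
  proof -
    obtain m n where "x \<in> f m" "y \<in> f n" using xy by blast
    then have "x \<in> f (max m n)" "y \<in> f (max m n)"
      using mono[of m "max m n"] mono[of n "max m n"] by auto
    then show ?thesis using f(1)[of "max m n"] xy by (auto simp: pairwise_def)
  qed
  then have "pairwise orthogonal ?B" by (auto simp: pairwise_def)
  moreover have "\<forall>e\<in>?B. norm e = 1" using f(1) by auto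
  moreover have "D \<subseteq> span ?B"
  proof
    fix d assume "d \<in> D"
    then obtain n where "d = from_nat_into D n"
      using from_nat_into_surj[OF D(1)] by metis
    then show "d \<in> span ?B"
      using f(3)[of n] span_mono[of "f (Suc n)" ?B] by auto
  qed
  then have "x \<in> closure (span ?B)" for x
    unfolding closure_iff_nhds_not_empty using D(2) by blast
  ultimately show ?thesis unfolding orthonormal_basis_def by blast
qed

text \<open>Square-summability of \<open>norm (G e)\<close> over an orthonormal basis, the inner product
  and the norm below do not depend on the basis; \<open>onb\<close> fixes one of them.\<close>

definition onb :: "'a::real_inner set" where
  "onb = (SOME B. orthonormal_basis B)"

lemma orthonormal_basis_onb:
  "orthonormal_basis (onb :: 'a::{real_inner,second_countable_topology} set)"
  unfolding onb_def by (rule someI_ex) (rule orthonormal_basis_exists)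

typedef (overloaded) ('a, 'b) hilbert_schmidt =
  "{G :: 'a::real_inner \<Rightarrow>\<^sub>L 'b::real_inner. (\<lambda>e. (norm (blinfun_apply G e))\<^sup>2) summable_on onb}"
  morphisms blinfun_of_hs Abs_hilbert_schmidt
  by (intro exI[of _ 0]) simp

setup_lifting type_definition_hilbert_schmidt

lemma hs_summable_add:
  fixes f g :: "'i \<Rightarrow> 'b::real_inner"
  assumes "(\<lambda>e. (norm (f e))\<^sup>2) summable_on A" "(\<lambda>e. (norm (g e))\<^sup>2) summable_on A"
  shows "(\<lambda>e. (norm (f e + g e))\<^sup>2) summable_on A"
proof (rule summable_on_comparison_test)
  show "(\<lambda>e. 2 * (norm (f e))\<^sup>2 + 2 * (norm (g e))\<^sup>2) summable_on A"
    using assms by (intro summable_on_add summable_on_cmult_right)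
  fix e
  have "0 \<le> (norm (f e - g e))\<^sup>2" by simp
  then show "(norm (f e + g e))\<^sup>2 \<le> 2 * (norm (f e))\<^sup>2 + 2 * (norm (g e))\<^sup>2"
    by (simp add: power2_norm_eq_inner inner_add_left inner_add_right inner_diff_left
        inner_diff_right inner_commute)
qed simp

lemma hs_summable_scale:
  fixes f :: "'i \<Rightarrow> 'b::real_inner"
  assumes "(\<lambda>e. (norm (f e))\<^sup>2) summable_on A"
  shows "(\<lambda>e. (norm (c *\<^sub>R f e))\<^sup>2) summable_on A"
  using summable_on_cmult_right[OF assms, of "c\<^sup>2"] by (simp add: power_mult_distrib)

lemma hs_summable_inner:
  fixes f g :: "'i \<Rightarrow> 'b::real_inner"
  assumes "(\<lambda>e. (norm (f e))\<^sup>2) summable_on A" "(\<lambda>e. (norm (g e))\<^sup>2) summable_on A"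
  shows "(\<lambda>e. f e \<bullet> g e) summable_on A"
proof -
  have "(\<lambda>e. 1/2 * ((norm (f e + g e))\<^sup>2 + (-1) * ((norm (f e))\<^sup>2 + (norm (g e))\<^sup>2))) summable_on A"
    using assms hs_summable_add[OF assms]
    by (intro summable_on_add summable_on_cmult_right)
  moreover have "f e \<bullet> g e = 1/2 * ((norm (f e + g e))\<^sup>2 + (-1) * ((norm (f e))\<^sup>2 + (norm (g e))\<^sup>2))" for e
    by (simp add: power2_norm_eq_inner inner_add_left inner_add_right inner_commute)
  ultimately show ?thesis by (simp only:)
qed

instantiation hilbert_schmidt :: (real_inner, real_inner) real_vector
begin

lift_definition zero_hilbert_schmidt :: "('a, 'b) hilbert_schmidt" is 0
  by simp

lift_definition plus_hilbert_schmidt ::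
  "('a, 'b) hilbert_schmidt \<Rightarrow> ('a, 'b) hilbert_schmidt \<Rightarrow> ('a, 'b) hilbert_schmidt" is "(+)"
  by (simp add: blinfun.add_left hs_summable_add)

lift_definition uminus_hilbert_schmidt ::
  "('a, 'b) hilbert_schmidt \<Rightarrow> ('a, 'b) hilbert_schmidt" is uminus
  by (simp add: blinfun.minus_left)

definition minus_hilbert_schmidt ::
  "('a, 'b) hilbert_schmidt \<Rightarrow> ('a, 'b) hilbert_schmidt \<Rightarrow> ('a, 'b) hilbert_schmidt" where
  "minus_hilbert_schmidt G H = G + (- H)"

lift_definition scaleR_hilbert_schmidt ::
  "real \<Rightarrow> ('a, 'b) hilbert_schmidt \<Rightarrow> ('a, 'b) hilbert_schmidt" is scaleR
  by (simp only: blinfun.scaleR_left mem_Collect_eq hs_summable_scale)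

instance
  by standard
    (unfold minus_hilbert_schmidt_def, (transfer, simp add: algebra_simps)+)

end

instantiation hilbert_schmidt ::
  ("{real_inner,second_countable_topology}", real_inner) real_inner
begin

definition inner_hilbert_schmidt ::
  "('a, 'b) hilbert_schmidt \<Rightarrow> ('a, 'b) hilbert_schmidt \<Rightarrow> real" where
  "G \<bullet> H = (\<Sum>\<^sub>\<infinity>e\<in>onb. blinfun_of_hs G e \<bullet> blinfun_of_hs H e)"

definition norm_hilbert_schmidt :: "('a, 'b) hilbert_schmidt \<Rightarrow> real" where
  "norm (G :: ('a, 'b) hilbert_schmidt) = sqrt (G \<bullet> G)"

definition dist_hilbert_schmidt ::
  "('a, 'b) hilbert_schmidt \<Rightarrow> ('a, 'b) hilbert_schmidt \<Rightarrow> real" where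
  "dist (G :: ('a, 'b) hilbert_schmidt) H = norm (G - H)"

definition sgn_hilbert_schmidt :: "('a, 'b) hilbert_schmidt \<Rightarrow> ('a, 'b) hilbert_schmidt" where
  "sgn (G :: ('a, 'b) hilbert_schmidt) = G /\<^sub>R norm G"

definition uniformity_hilbert_schmidt :: "(('a, 'b) hilbert_schmidt \<times> ('a, 'b) hilbert_schmidt) filter" where
  "(uniformity :: (('a, 'b) hilbert_schmidt \<times> ('a, 'b) hilbert_schmidt) filter) =
     (INF \<epsilon>\<in>{0<..}. principal {(G, H). dist G H < \<epsilon>})"

definition open_hilbert_schmidt :: "('a, 'b) hilbert_schmidt set \<Rightarrow> bool" where
  "open (U :: ('a, 'b) hilbert_schmidt set) \<longleftrightarrow>
     (\<forall>G\<in>U. \<forall>\<^sub>F (G', H) in uniformity. G' = G \<longrightarrow> H \<in> U)"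

instance
proof
  fix G H K :: "('a, 'b) hilbert_schmidt" and c :: real
  have summable: "(\<lambda>e. blinfun_of_hs G e \<bullet> blinfun_of_hs H e) summable_on onb"
    for G H :: "('a, 'b) hilbert_schmidt"
    using blinfun_of_hs[of G] blinfun_of_hs[of H] by (auto intro: hs_summable_inner)
  show "G \<bullet> H = H \<bullet> G"
    by (simp add: inner_hilbert_schmidt_def inner_commute)
  show "(G + H) \<bullet> K = G \<bullet> K + H \<bullet> K"
    by (simp add: inner_hilbert_schmidt_def plus_hilbert_schmidt.rep_eq blinfun.add_left
        inner_add_left infsum_add summable)
  show "(c *\<^sub>R G) \<bullet> H = c * (G \<bullet> H)"
    by (simp add: inner_hilbert_schmidt_def scaleR_hilbert_schmidt.rep_eq blinfun.scaleR_left
        infsum_cmult_right')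
  show "0 \<le> G \<bullet> G"
    unfolding inner_hilbert_schmidt_def by (rule infsum_nonneg) simp
  show "G \<bullet> G = 0 \<longleftrightarrow> G = 0"
  proof
    assume 0: "G \<bullet> G = 0"
    have e0: "blinfun_of_hs G e = 0" if "e \<in> onb" for e
      using nonneg_infsum_le_0D[OF _ summable[of G G] _ that] 0
      by (simp add: inner_hilbert_schmidt_def)
    have "blinfun_of_hs G x = 0" if "x \<in> span onb" for x
      using that e0 by (induction rule: span_induct_alt) (auto simp: blinfun.add_right blinfun.scaleR_right)
    then have "blinfun_of_hs G x = 0" for x
      using continuous_constant_on_closure[of "span onb" "blinfun_of_hs G" 0 x]
        orthonormal_basis_onb[where 'a = 'a]
      by (simp add: orthonormal_basis_def blinfun.continuous_on)
    then show "G = 0"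
      by (metis blinfun_eqI blinfun_of_hs_inject zero_blinfun.rep_eq zero_hilbert_schmidt.rep_eq)
  next
    assume "G = 0"
    then show "G \<bullet> G = 0"
      by (simp add: inner_hilbert_schmidt_def zero_hilbert_schmidt.rep_eq)
  qed
qed (simp_all only: norm_hilbert_schmidt_def dist_hilbert_schmidt_def sgn_hilbert_schmidt_def
      uniformity_hilbert_schmidt_def open_hilbert_schmidt_def)

end

lift_definition hs_tensor ::
  "'a::{real_inner,second_countable_topology} \<Rightarrow> 'b::real_inner \<Rightarrow> ('a, 'b) hilbert_schmidt"
  (infixr "\<otimes>\<^sub>H" 75) is "\<lambda>u v. Blinfun (\<lambda>a. (u \<bullet> a) *\<^sub>R v)"
proof -
  fix u :: 'a and v :: 'b
  have apply_eq: "blinfun_apply (Blinfun (\<lambda>a. (u \<bullet> a) *\<^sub>R v)) = (\<lambda>a. (u \<bullet> a) *\<^sub>R v)"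
    by (intro bounded_linear_Blinfun_apply bounded_linear_intros)
  have "(\<lambda>e. (u \<bullet> e)\<^sup>2) summable_on onb"
  proof (rule nonneg_bdd_above_summable_on)
    have B: "pairwise orthogonal (onb :: 'a set)" "\<forall>e\<in>(onb :: 'a set). norm e = 1"
      using orthonormal_basis_onb[where 'a = 'a] by (auto simp: orthonormal_basis_def)
    show "bdd_above (sum (\<lambda>e. (u \<bullet> e)\<^sup>2) ` {F. F \<subseteq> onb \<and> finite F})"
      using B by (intro bdd_aboveI[of _ "(norm u)\<^sup>2"])
        (auto intro!: bessel_finite intro: pairwise_subset)
  qed simp
  then have "(\<lambda>e. (norm v)\<^sup>2 * (u \<bullet> e)\<^sup>2) summable_on onb"
    by (rule summable_on_cmult_right)
  then show "(\<lambda>e. (norm (blinfun_apply (Blinfun (\<lambda>a. (u \<bullet> a) *\<^sub>R v)) e))\<^sup>2) summable_on onb"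
    by (simp add: apply_eq power_mult_distrib mult.commute)
qed

lemma hs_tensor_apply: "blinfun_of_hs (u \<otimes>\<^sub>H v) a = (u \<bullet> a) *\<^sub>R v"
  unfolding hs_tensor.rep_eq
  by (subst bounded_linear_Blinfun_apply) (auto intro!: bounded_linear_intros)

text \<open>The positive singular values of \<open>G\<close> are the \<open>s > 0\<close> such that \<open>s\<^sup>2\<close> is an eigenvalue
  of \<open>G\<^sup>* G\<close>. The eigenspaces for \<open>s > 0\<close> are finite-dimensional because \<open>G\<close> is compact,
  so \<open>dim\<close> is the true multiplicity, and it is \<open>0\<close> when \<open>s\<close> is not a singular value.\<close>

definition singular_multiplicity ::
  "('a::{real_inner,complete_space,second_countable_topology},
    'b::{real_inner,complete_space,second_countable_topology}) hilbert_schmidt \<Rightarrow> real \<Rightarrow> nat" where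
  "singular_multiplicity G s =
     dim {x. adjoint (blinfun_of_hs G) (blinfun_of_hs G x) = s\<^sup>2 *\<^sub>R x}"

definition nuclear_norm ::
  "('a::{real_inner,complete_space,second_countable_topology},
    'b::{real_inner,complete_space,second_countable_topology}) hilbert_schmidt \<Rightarrow> ennreal" where
  "nuclear_norm G = (\<Sum>\<^sub>\<infinity>s\<in>{0<..}. of_nat (singular_multiplicity G s) * ennreal s)"

text \<open>Families of \<open>N \<ge> 1\<close> operators are vectors indexed by a finite type \<open>'n\<close> with
  \<open>CARD('n) = N\<close>. The adjoint \<open>adjoint \<Phi>\<close> exists since the Hilbert--Schmidt operators
  form a Hilbert space.\<close>

definition NDSC ::
  "(('a::{real_inner,complete_space,second_countable_topology},
     'b::{real_inner,complete_space,second_countable_topology}) hilbert_schmidt ^ 'n::finite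
    \<Rightarrow> 'c::{real_inner,complete_space,second_countable_topology})
   \<Rightarrow> ('n \<Rightarrow> 'a) \<Rightarrow> ('n \<Rightarrow> 'b) \<Rightarrow> bool" where
  "NDSC \<Phi> u v \<longleftrightarrow>
     (\<exists>H \<in> range (adjoint \<Phi>). \<forall>i. \<exists>W.
        H $ i = u i \<otimes>\<^sub>H v i + W \<and>
        blinfun_of_hs W (u i) = 0 \<and>
        adjoint (blinfun_of_hs W) (v i) = 0 \<and>
        norm (blinfun_of_hs W) < 1)"

end

theory Submission
  imports Defs
begin

text \<open>If \<open>H = \<Phi>\<^sup>* y\<close> is the dual certificate, then \<open>\<Sum>i. \<langle>H\<^sub>i, F\<^sub>i\<rangle> = \<langle>y, z\<rangle>\<close> is the same for
  all feasible \<open>F\<close>, and equals \<open>\<Sum>i. \<sigma> i\<close>. Expanding \<open>F\<^sub>i\<close> along its singular vectors and using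
  that \<open>H\<^sub>i\<close> is a contraction gives \<open>\<langle>H\<^sub>i, F\<^sub>i\<rangle> \<le> \<parallel>F\<^sub>i\<parallel>\<^sub>*\<close>, which proves optimality. Equality forces
  \<open>H\<^sub>i\<close> to be isometric on every right singular vector of \<open>F\<^sub>i\<close>; as \<open>\<parallel>W\<^sub>i\<parallel> < 1\<close>, such a vector is \<open>\<plusminus> u\<^sub>i\<close>.
  Hence every minimizer lies in the cone on which \<open>\<Phi>\<close> is injective.\<close>

section \<open>Riesz representation and adjoints\<close>

text \<open>The singular vectors have to be tied to a nuclear norm defined through dimensions of
  eigenspaces. One inequality suffices: finite sums of \<open>norm (G a)\<close> over singular
  vectors stay below \<open>nuclear_norm G\<close>. The exact value is computed only for rank one,
  where the minimizer needs it. The operators \<open>x \<otimes>\<^sub>H b\<close> serve as test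
  elements: pairing \<open>G\<close> with them gives the inner product of \<open>G x\<close> with
  \<open>b\<close>, so identities between operators become pointwise, and Bessel's inequality holds
  for every orthonormal family, not only for the fixed \<open>onb\<close>. Completeness enters
  because \<open>adjoint\<close> is a choice that satisfies its identity only if a witness exists;
  the Riesz theorem provides one, and for \<open>\<Phi>\<close> this requires the Hilbert-Schmidt
  operators to be complete. Since the objective may be infinite, competitors are restricted to those
  no worse than the candidate, for which every nuclear norm is a real number.\<close>

lemma norm_diff_scaleR:
  fixes a x :: "'a::real_inner"
  shows "(norm (a - c *\<^sub>R x))\<^sup>2 = (norm a)\<^sup>2 - 2 * c * (a \<bullet> x) + c\<^sup>2 * (norm x)\<^sup>2"
  unfolding power2_norm_eq_inner
  by (simp add: inner_diff_left inner_diff_right inner_commute power2_eq_square algebra_simps)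

text \<open>Variational proof: the representing vector is the minimizer of \<open>J\<close>, the
  quadratic energy whose stationarity condition is the claimed identity. Completeness is used once,
  to give a minimizing sequence a limit.\<close>

lemma riesz_representation:
  fixes f :: "'h::{real_inner,complete_space} \<Rightarrow> real"
  assumes "bounded_linear f"
  obtains w where "\<And>x. f x = w \<bullet> x"
proof -
  interpret f: bounded_linear f by fact
  define J where "J x = x \<bullet> x - 2 * f x" for x
  obtain K where K: "\<And>x. norm (f x) \<le> norm x * K" using f.bounded by blast
  have J_lower: "- K\<^sup>2 \<le> J x" for x
  proof -
    have "0 \<le> (norm x - K)\<^sup>2" by simp
    then show ?thesis using K[of x]
      by (simp add: J_def power2_eq_square algebra_simps flip: dot_square_norm) (simp add: dot_square_norm power2_eq_square)
  qed
  then have bdd: "bdd_below (range J)" by (intro bdd_belowI[of _ "- K\<^sup>2"]) auto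
  define m where "m = Inf (range J)"
  have m_le: "m \<le> J x" for x unfolding m_def using bdd by (intro cInf_lower) auto
  have "\<exists>x. J x < m + 1 / real (Suc n)" for n
  proof -
    have "Inf (range J) < m + 1 / real (Suc n)" by (simp add: m_def)
    then show ?thesis using cInf_lessD[of "range J"] by auto
  qed
  then obtain X where X: "\<And>n. J (X n) < m + 1 / real (Suc n)" by metis
  \<comment> \<open>The parallelogram law for \<open>J\<close>: the midpoint cannot lie below the
    infimum \<open>m\<close>, so two near-minimizers are close to each other.\<close>
  have parallelogram: "(dist x y)\<^sup>2 \<le> 2 * (J x - m) + 2 * (J y - m)" for x y
  proof -
    have "(dist x y)\<^sup>2 = 2 * J x + 2 * J y - 4 * J ((1/2) *\<^sub>R (x + y))"
      by (simp add: J_def dist_norm power2_norm_eq_inner inner_add_left inner_add_right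
          inner_diff_left inner_diff_right inner_commute f.add f.scale algebra_simps)
    then show ?thesis using m_le[of "(1/2) *\<^sub>R (x + y)"] by simp
  qed
  have "Cauchy X"
  proof (rule metric_CauchyI)
    fix e :: real assume "0 < e"
    then obtain n where n: "1 / real (Suc n) < e\<^sup>2 / 4"
      using nat_approx_posE[of "e\<^sup>2 / 4"] by (metis divide_pos_pos zero_less_numeral zero_less_power)
    have J_n: "J (X k) - m < e\<^sup>2 / 4" if "k \<ge> n" for k
    proof -
      have "1 / real (Suc k) \<le> 1 / real (Suc n)" using that by (intro divide_left_mono) auto
      then show ?thesis using X[of k] n by linarith
    qed
    have "dist (X i) (X j) < e" if "i \<ge> n" "j \<ge> n" for i j
    proof -
      have "(dist (X i) (X j))\<^sup>2 < e\<^sup>2"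
        using parallelogram[of "X i" "X j"] J_n[OF that(1)] J_n[OF that(2)] by argo
      then show ?thesis using \<open>0 < e\<close> by (simp add: power_less_imp_less_base)
    qed
    then show "\<exists>M. \<forall>i\<ge>M. \<forall>j\<ge>M. dist (X i) (X j) < e" by blast
  qed
  then obtain w where w: "X \<longlonglongrightarrow> w" using Cauchy_convergent convergent_def by blast
  have "(\<lambda>n. J (X n)) \<longlonglongrightarrow> J w"
    unfolding J_def by (intro tendsto_intros f.tendsto w)
  moreover have "(\<lambda>n. m + 1 / real (Suc n)) \<longlonglongrightarrow> m + 0"
    by (intro tendsto_intros LIMSEQ_Suc[OF lim_1_over_n])
  ultimately have "J w \<le> m + 0"
    using X by (intro LIMSEQ_le) (auto intro: less_imp_le)
  then have min: "J w \<le> J y" for y using m_le[of y] by simp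
  have "f x = w \<bullet> x" for x
  proof (cases "x = 0")
    case False
    define d where "d = f x - w \<bullet> x"
    \<comment> \<open>The step length minimizes \<open>J\<close> on the line through
      \<open>w\<close> in direction \<open>x\<close>; the resulting decrease must be zero, hence
      \<open>d = 0\<close>.\<close>
    have "J (w + (d / (x \<bullet> x)) *\<^sub>R x) = J w - d\<^sup>2 / (x \<bullet> x)"
      using False by (simp add: J_def d_def inner_add_left inner_add_right f.add f.scale inner_commute
          field_simps power2_eq_square)
    with min[of "w + (d / (x \<bullet> x)) *\<^sub>R x"] have "d\<^sup>2 / (x \<bullet> x) \<le> 0" by linarith
    then have "d = 0" using False
      by (metis divide_pos_pos inner_gt_zero_iff not_le zero_less_power2)
    then show ?thesis by (simp add: d_def)
  qed simp
  then show ?thesis by (rule that)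
qed

text \<open>For each \<open>y\<close> the functional sending \<open>x\<close> to
  \<open>f x \<bullet> y\<close> is bounded, so Riesz supplies the value at \<open>y\<close> of an
  operator of the kind that \<open>adjoint\<close> chooses.\<close>

lemma inner_adjoint:
  fixes f :: "'h::{real_inner,complete_space} \<Rightarrow> 'k::real_inner"
  assumes "bounded_linear f"
  shows "x \<bullet> adjoint f y = f x \<bullet> y"
proof -
  have "\<exists>w. \<forall>x. f x \<bullet> y = x \<bullet> w" for y
    using riesz_representation[OF bounded_linear_inner_left_comp[OF assms, of y]] inner_commute by metis
  then obtain g where g: "\<forall>x y. f x \<bullet> y = x \<bullet> g y" by metis
  then show ?thesis using adjoint_unique[OF g] by simp
qed

lemma bounded_linear_adjoint:
  fixes f :: "'h::{real_inner,complete_space} \<Rightarrow> 'k::real_inner"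
  assumes "bounded_linear f"
  shows "bounded_linear (adjoint f)"
proof -
  note adj = inner_adjoint[OF assms]
  obtain K where "0 < K" and K: "\<And>x. norm (f x) \<le> norm x * K"
    using bounded_linear.pos_bounded[OF assms] by blast
  show ?thesis
  proof (rule bounded_linear_intro)
    fix x y r
    show "adjoint f (x + y) = adjoint f x + adjoint f y"
      by (subst vector_eq_rdot[symmetric]) (simp add: adj inner_add_right inner_commute[of "adjoint f _"] inner_add_left)
    show "adjoint f (r *\<^sub>R x) = r *\<^sub>R adjoint f x"
      by (subst vector_eq_rdot[symmetric]) (simp add: adj inner_commute[of "adjoint f _"])
    have "norm (adjoint f x) * norm (adjoint f x) = f (adjoint f x) \<bullet> x"
      by (simp flip: adj add: dot_square_norm power2_eq_square)
    also have "\<dots> \<le> norm (f (adjoint f x)) * norm x" by (rule norm_cauchy_schwarz)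
    also have "\<dots> \<le> (norm (adjoint f x) * K) * norm x" by (intro mult_right_mono K) simp
    finally have "norm (adjoint f x) * norm (adjoint f x) \<le> norm (adjoint f x) * (norm x * K)"
      by (simp add: mult_ac)
    then show "norm (adjoint f x) \<le> norm x * K"
      using \<open>0 < K\<close> by (cases "adjoint f x = 0") (simp_all add: zero_le_mult_iff)
  qed
qed

section \<open>The Hilbert space of Hilbert--Schmidt operators\<close>

lemma bounded_linear_blinfun_of_hs: "bounded_linear (blinfun_apply (blinfun_of_hs G))"
  by (rule blinfun.bounded_linear_right)

lemma blinfun_of_hs_add: "blinfun_of_hs (G + H) x = blinfun_of_hs G x + blinfun_of_hs H x"
  by (simp add: plus_hilbert_schmidt.rep_eq blinfun.add_left)

lemma blinfun_of_hs_diff: "blinfun_of_hs (G - H) x = blinfun_of_hs G x - blinfun_of_hs H x"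
  unfolding minus_hilbert_schmidt_def
  by (simp add: blinfun_of_hs_add uminus_hilbert_schmidt.rep_eq blinfun.minus_left
      del: add_uminus_conv_diff)

lemma blinfun_of_hs_scaleR: "blinfun_of_hs (c *\<^sub>R G) x = c *\<^sub>R blinfun_of_hs G x"
  by (simp add: scaleR_hilbert_schmidt.rep_eq blinfun.scaleR_left)

lemma blinfun_of_hs_zero: "blinfun_of_hs 0 x = 0"
  by (simp add: zero_hilbert_schmidt.rep_eq)

lemma blinfun_of_hs_sum: "blinfun_of_hs (sum f S) x = (\<Sum>s\<in>S. blinfun_of_hs (f s) x)"
  by (induction S rule: infinite_finite_induct) (simp_all add: blinfun_of_hs_zero blinfun_of_hs_add)

lemma hs_eqI:
  fixes G H :: "('a::real_inner, 'b::real_inner) hilbert_schmidt"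
  assumes "\<And>x. blinfun_of_hs G x = blinfun_of_hs H x"
  shows "G = H"
  by (rule blinfun_of_hs_inject[THEN iffD1], rule blinfun_eqI) (rule assms)

lemma onb_orthonormal:
  "pairwise orthogonal (onb :: 'a::{real_inner,second_countable_topology} set)"
  "\<And>e. e \<in> (onb :: 'a set) \<Longrightarrow> norm e = 1"
  using orthonormal_basis_onb[where 'a = 'a] by (auto simp: orthonormal_basis_def)

lemma inner_onb:
  assumes "e \<in> onb" "e' \<in> onb"
  shows "e \<bullet> e' = (if e = (e' :: 'a::{real_inner,second_countable_topology}) then 1 else 0)"
  using assms onb_orthonormal(2)[of e] pairwiseD[OF onb_orthonormal(1) assms]
  by (auto simp: orthogonal_def norm_eq_1)

lemma inner_hs_has_sum:
  fixes G H :: "('a::{real_inner,second_countable_topology}, 'b::real_inner) hilbert_schmidt"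
  shows "((\<lambda>e. blinfun_of_hs G e \<bullet> blinfun_of_hs H e) has_sum G \<bullet> H) onb"
  unfolding inner_hilbert_schmidt_def
  using blinfun_of_hs[of G] blinfun_of_hs[of H] by (intro has_sum_infsum hs_summable_inner) auto

lemma norm_hs_has_sum:
  fixes G :: "('a::{real_inner,second_countable_topology}, 'b::real_inner) hilbert_schmidt"
  shows "((\<lambda>e. (norm (blinfun_of_hs G e))\<^sup>2) has_sum (norm G)\<^sup>2) onb"
  using inner_hs_has_sum[of G G] by (simp add: power2_norm_eq_inner)

lemma hs_tensor_add_left: "(x + y) \<otimes>\<^sub>H b = x \<otimes>\<^sub>H b + y \<otimes>\<^sub>H b"
  by (rule hs_eqI) (simp add: hs_tensor_apply blinfun_of_hs_add inner_add_left scaleR_add_left)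

lemma hs_tensor_scaleR_left: "(c *\<^sub>R x) \<otimes>\<^sub>H b = c *\<^sub>R (x \<otimes>\<^sub>H b)"
  by (rule hs_eqI) (simp add: hs_tensor_apply blinfun_of_hs_scaleR)

text \<open>Bessel gives only this bound, but it makes the tensor bounded in its left argument. That
  is what \<open>inner_hs_tensor\<close> needs, and equality then follows from there.\<close>

lemma norm_hs_tensor_le: "norm (x \<otimes>\<^sub>H b) \<le> norm x * norm b"
proof -
  have "(norm (x \<otimes>\<^sub>H b))\<^sup>2 \<le> (norm x * norm b)\<^sup>2"
  proof (rule has_sum_le_finite_sums[OF norm_hs_has_sum])
    fix F :: "'a set" assume F: "finite F" "F \<subseteq> onb"
    then have "(\<Sum>e\<in>F. (x \<bullet> e)\<^sup>2) \<le> (norm x)\<^sup>2"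
      using onb_orthonormal by (intro bessel_finite) (auto intro: pairwise_subset)
    then have "(\<Sum>e\<in>F. (x \<bullet> e)\<^sup>2) * (norm b)\<^sup>2 \<le> (norm x)\<^sup>2 * (norm b)\<^sup>2"
      by (intro mult_right_mono) auto
    then show "(\<Sum>e\<in>F. (norm (blinfun_of_hs (x \<otimes>\<^sub>H b) e))\<^sup>2) \<le> (norm x * norm b)\<^sup>2"
      by (simp add: hs_tensor_apply power_mult_distrib sum_distrib_right)
  qed
  then show ?thesis by (rule power2_le_imp_le) simp
qed

text \<open>Both sides are continuous linear functionals of \<open>a\<close> that agree on \<open>onb\<close>.\<close>

lemma inner_hs_tensor:
  fixes G :: "('a::{real_inner,second_countable_topology}, 'b::real_inner) hilbert_schmidt"
  shows "G \<bullet> (a \<otimes>\<^sub>H b) = blinfun_of_hs G a \<bullet> b"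
proof -
  have "bounded_linear (\<lambda>a. a \<otimes>\<^sub>H b :: ('a, 'b) hilbert_schmidt)"
    by (rule bounded_linear_intro[of _ "norm b"])
      (simp_all add: hs_tensor_add_left hs_tensor_scaleR_left norm_hs_tensor_le)
  then have "bounded_linear (\<lambda>a. G \<bullet> (a \<otimes>\<^sub>H b))"
    by (rule bounded_linear_inner_right_comp)
  then have h: "bounded_linear (\<lambda>a. G \<bullet> (a \<otimes>\<^sub>H b) - blinfun_of_hs G a \<bullet> b)"
    by (intro bounded_linear_sub bounded_linear_inner_left_comp bounded_linear_blinfun_of_hs)
  interpret h: bounded_linear "\<lambda>a. G \<bullet> (a \<otimes>\<^sub>H b) - blinfun_of_hs G a \<bullet> b" by (rule h)
  have "G \<bullet> (e \<otimes>\<^sub>H b) - blinfun_of_hs G e \<bullet> b = 0" if "e \<in> onb" for e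
  proof -
    have "((\<lambda>e'. if e' = e then blinfun_of_hs G e \<bullet> b else 0) has_sum G \<bullet> (e \<otimes>\<^sub>H b)) onb"
      using inner_hs_has_sum[of G "e \<otimes>\<^sub>H b"]
      by (rule has_sum_cong[THEN iffD1, rotated]) (use that in \<open>auto simp: hs_tensor_apply inner_onb\<close>)
    moreover have "((\<lambda>e'. if e' = e then blinfun_of_hs G e \<bullet> b else 0) has_sum blinfun_of_hs G e \<bullet> b) onb"
      using that by (intro has_sum_finite_neutralI[of "{e}"]) auto
    ultimately show ?thesis using has_sum_unique by fastforce
  qed
  note onb = this
  have "G \<bullet> (x \<otimes>\<^sub>H b) - blinfun_of_hs G x \<bullet> b = 0" if "x \<in> span onb" for x
    using that
  proof (induction rule: span_induct_alt)
    case base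
    show ?case by (rule h.zero)
  next
    case (step c x y)
    then show ?case using h.add[of "c *\<^sub>R x" y] h.scale[of c x] onb[of x] by simp
  qed
  then have "G \<bullet> (a \<otimes>\<^sub>H b) - blinfun_of_hs G a \<bullet> b = 0"
    using continuous_constant_on_closure[of "span onb" "\<lambda>a. G \<bullet> (a \<otimes>\<^sub>H b) - blinfun_of_hs G a \<bullet> b" 0 a]
      orthonormal_basis_onb[where 'a = 'a] linear_continuous_on[OF h]
    by (simp add: orthonormal_basis_def)
  then show ?thesis by simp
qed

lemma norm_hs_tensor [simp]: "norm (x \<otimes>\<^sub>H b) = norm x * norm b"
proof -
  have "(norm (x \<otimes>\<^sub>H b))\<^sup>2 = (norm x * norm b)\<^sup>2"
    by (simp add: power2_norm_eq_inner inner_hs_tensor hs_tensor_apply power_mult_distrib)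
  then show ?thesis by (simp add: power2_eq_iff_nonneg)
qed

text \<open>Cauchy-Schwarz against the test operator formed from \<open>x\<close> and
  \<open>G x\<close>.\<close>

lemma norm_hs_apply_le:
  fixes G :: "('a::{real_inner,second_countable_topology}, 'b::real_inner) hilbert_schmidt"
  shows "norm (blinfun_of_hs G x) \<le> norm G * norm x"
proof (cases "blinfun_of_hs G x = 0")
  case False
  have "norm (blinfun_of_hs G x) * norm (blinfun_of_hs G x) = G \<bullet> (x \<otimes>\<^sub>H blinfun_of_hs G x)"
    by (simp add: inner_hs_tensor dot_square_norm power2_eq_square)
  also have "\<dots> \<le> norm G * norm (x \<otimes>\<^sub>H blinfun_of_hs G x)" by (rule norm_cauchy_schwarz)
  finally show ?thesis using False by (simp add: mult.assoc[symmetric])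
qed simp

text \<open>The subtracted sum is \<open>G\<close> composed with the orthogonal projection onto
  \<open>span C\<close>, so this is Pythagoras. It measures the finite-rank error exactly, and for
  any finite orthonormal \<open>C\<close>.\<close>

lemma hs_bessel:
  fixes G :: "('a::{real_inner,second_countable_topology}, 'b::real_inner) hilbert_schmidt"
  assumes "finite C" "pairwise orthogonal C" "\<forall>e\<in>C. norm e = 1"
  shows "(norm (G - (\<Sum>a\<in>C. a \<otimes>\<^sub>H blinfun_of_hs G a)))\<^sup>2 = (norm G)\<^sup>2 - (\<Sum>a\<in>C. (norm (blinfun_of_hs G a))\<^sup>2)"
proof -
  let ?S = "\<Sum>a\<in>C. a \<otimes>\<^sub>H blinfun_of_hs G a"
  have GS: "G \<bullet> ?S = (\<Sum>a\<in>C. (norm (blinfun_of_hs G a))\<^sup>2)"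
    by (simp add: inner_sum_right inner_hs_tensor dot_square_norm)
  have "blinfun_of_hs ?S a = blinfun_of_hs G a" if "a \<in> C" for a
  proof -
    have "blinfun_of_hs ?S a = (\<Sum>a'\<in>C. if a' = a then blinfun_of_hs G a else 0)"
      unfolding blinfun_of_hs_sum using assms that
      by (intro sum.cong) (auto simp: hs_tensor_apply pairwise_def orthogonal_def norm_eq_1)
    then show ?thesis using assms(1) that by simp
  qed
  then have SS: "?S \<bullet> ?S = (\<Sum>a\<in>C. (norm (blinfun_of_hs G a))\<^sup>2)"
    by (subst inner_sum_right) (simp add: inner_hs_tensor dot_square_norm)
  show ?thesis
    using GS SS by (simp add: power2_norm_eq_inner inner_diff_left inner_diff_right inner_commute)
qed

lemma hs_bessel_le:
  fixes G :: "('a::{real_inner,second_countable_topology}, 'b::real_inner) hilbert_schmidt"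
  assumes "finite C" "pairwise orthogonal C" "\<forall>e\<in>C. norm e = 1"
  shows "(\<Sum>a\<in>C. (norm (blinfun_of_hs G a))\<^sup>2) \<le> (norm G)\<^sup>2"
proof -
  have "0 \<le> (norm G)\<^sup>2 - (\<Sum>a\<in>C. (norm (blinfun_of_hs G a))\<^sup>2)"
    unfolding hs_bessel[OF assms, symmetric] by simp
  then show ?thesis by simp
qed

text \<open>The limit is first built pointwise, using that the operator norm is at most the
  Hilbert-Schmidt norm. Square summability and convergence are then recovered from finite partial
  sums over \<open>onb\<close>, where pointwise limits are harmless.\<close>

instance hilbert_schmidt ::
  ("{real_inner,second_countable_topology}", "{real_inner,complete_space}") complete_space
proof
  fix G :: "nat \<Rightarrow> ('a, 'b) hilbert_schmidt"
  assume Cauchy: "Cauchy G"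
  let ?T = "\<lambda>n. blinfun_of_hs (G n)"
  have "Cauchy (\<lambda>n. ?T n x)" for x
  proof -
    have "norm (?T m x - ?T n x) \<le> norm (G m - G n) * norm x" for m n
      using norm_hs_apply_le[of "G m - G n" x] by (simp add: blinfun_of_hs_diff)
    moreover have "\<exists>M. \<forall>m\<ge>M. \<forall>n\<ge>M. norm (G m - G n) * norm x < e" if "e > 0" for e
    proof -
      have "0 < e / (norm x + 1)" using that by (simp add: add_nonneg_pos)
      then obtain M where M: "\<And>m n. m \<ge> M \<Longrightarrow> n \<ge> M \<Longrightarrow> norm (G m - G n) < e / (norm x + 1)"
        using CauchyD[OF Cauchy] by blast
      have "norm (G m - G n) * norm x < e" if "m \<ge> M" "n \<ge> M" for m n
      proof -
        have "norm (G m - G n) * norm x \<le> norm (G m - G n) * (norm x + 1)"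
          by (intro mult_left_mono) auto
        also have "\<dots> < e" using M[OF that] by (simp add: pos_less_divide_eq add_nonneg_pos)
        finally show ?thesis .
      qed
      then show ?thesis by blast
    qed
    ultimately show ?thesis by (intro CauchyI) (meson le_less_trans)
  qed
  then have "\<exists>y. (\<lambda>n. ?T n x) \<longlonglongrightarrow> y" for x
    using Cauchy_convergent convergent_def by blast
  then obtain L where L: "\<And>x. (\<lambda>n. ?T n x) \<longlonglongrightarrow> L x" by metis
  obtain K where K: "\<And>n. norm (G n) \<le> K"
    using cauchy_imp_bounded[OF Cauchy] by (auto simp: bounded_iff)
  have bl: "bounded_linear L"
  proof (rule bounded_linear_intro[of _ K])
    fix x y c
    show "L (x + y) = L x + L y"
      using L[of "x + y"] tendsto_add[OF L[of x] L[of y]] LIMSEQ_unique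
      by (simp add: blinfun.add_right)
    show "L (c *\<^sub>R x) = c *\<^sub>R L x"
      using L[of "c *\<^sub>R x"] tendsto_scaleR[OF tendsto_const L[of x], of c] LIMSEQ_unique
      by (simp add: blinfun.scaleR_right)
    have "norm (?T n x) \<le> norm x * K" for n
      using norm_hs_apply_le[of "G n" x] mult_right_mono[OF K[of n] norm_ge_zero[of x]]
      by (simp add: mult.commute)
    then show "norm (L x) \<le> norm x * K"
      using tendsto_norm[OF L[of x]] by (intro LIMSEQ_le_const2) auto
  qed
  have fin_onb: "finite F \<and> pairwise orthogonal F \<and> (\<forall>e\<in>F. norm e = 1)"
    if "finite F" "F \<subseteq> onb" for F :: "'a set"
    using that onb_orthonormal by (auto intro: pairwise_subset)
  have "(\<lambda>e. (norm (L e))\<^sup>2) summable_on onb"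
  proof (rule nonneg_bdd_above_summable_on)
    have "(\<Sum>e\<in>F. (norm (L e))\<^sup>2) \<le> K\<^sup>2" if "F \<subseteq> onb" "finite F" for F
    proof (rule LIMSEQ_le_const2)
      show "(\<lambda>n. \<Sum>e\<in>F. (norm (?T n e))\<^sup>2) \<longlonglongrightarrow> (\<Sum>e\<in>F. (norm (L e))\<^sup>2)"
        by (intro tendsto_intros L)
      have "(\<Sum>e\<in>F. (norm (?T n e))\<^sup>2) \<le> K\<^sup>2" for n
        using fin_onb[of F] that
        by (intro order_trans[OF hs_bessel_le power_mono[OF K norm_ge_zero]]) auto
      then show "\<exists>N. \<forall>n\<ge>N. (\<Sum>e\<in>F. (norm (?T n e))\<^sup>2) \<le> K\<^sup>2" by blast
    qed
    then show "bdd_above (sum (\<lambda>e. (norm (L e))\<^sup>2) ` {F. F \<subseteq> onb \<and> finite F})"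
      by (intro bdd_aboveI[of _ "K\<^sup>2"]) auto
  qed simp
  then have "Blinfun L \<in> {G. (\<lambda>e. (norm (blinfun_apply G e))\<^sup>2) summable_on onb}"
    using bl by (simp add: bounded_linear_Blinfun_apply)
  then obtain X :: "('a, 'b) hilbert_schmidt" where "blinfun_of_hs X = Blinfun L"
    using Abs_hilbert_schmidt_inverse by metis
  then have X: "blinfun_of_hs X x = L x" for x
    using bl by (simp add: bounded_linear_Blinfun_apply)
  have "G \<longlonglongrightarrow> X"
  proof (rule LIMSEQ_I)
    fix r :: real assume "0 < r"
    then obtain M where M: "\<And>m n. m \<ge> M \<Longrightarrow> n \<ge> M \<Longrightarrow> norm (G m - G n) < r / 2"
      using CauchyD[OF Cauchy, of "r / 2"] by auto
    have "norm (G n - X) < r" if "n \<ge> M" for n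
    proof -
      have "(norm (G n - X))\<^sup>2 \<le> (r / 2)\<^sup>2"
      proof (rule has_sum_le_finite_sums[OF norm_hs_has_sum])
        fix F :: "'a set" assume F: "finite F" "F \<subseteq> onb"
        \<comment> \<open>With \<open>n\<close> and the finite set \<open>F\<close> fixed,
          \<open>m\<close> tends to infinity; the Cauchy bound \<open>r / 2\<close> passes to the
          limit uniformly in \<open>F\<close>.\<close>
        have "(\<lambda>m. \<Sum>e\<in>F. (norm (blinfun_of_hs (G n - G m) e))\<^sup>2) \<longlonglongrightarrow>
            (\<Sum>e\<in>F. (norm (blinfun_of_hs (G n - X) e))\<^sup>2)"
          unfolding blinfun_of_hs_diff X by (intro tendsto_intros L)
        moreover have "(\<Sum>e\<in>F. (norm (blinfun_of_hs (G n - G m) e))\<^sup>2) \<le> (r / 2)\<^sup>2" if "m \<ge> M" for m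
          using fin_onb[of F] F less_imp_le[OF M[OF \<open>n \<ge> M\<close> that]]
          by (intro order_trans[OF hs_bessel_le power_mono]) auto
        ultimately show "(\<Sum>e\<in>F. (norm (blinfun_of_hs (G n - X) e))\<^sup>2) \<le> (r / 2)\<^sup>2"
          by (intro LIMSEQ_le_const2) auto
      qed
      then have "norm (G n - X) \<le> r / 2" by (rule power2_le_imp_le) (use \<open>0 < r\<close> in simp)
      then show ?thesis using \<open>0 < r\<close> by simp
    qed
    then show "\<exists>M. \<forall>n\<ge>M. norm (G n - X) < r" by blast
  qed
  then show "convergent G" by (auto simp: convergent_def)
qed

section \<open>Compactness and singular vectors\<close>

lemma hs_finite_rank_approx:
  fixes G :: "('a::{real_inner,second_countable_topology}, 'b::real_inner) hilbert_schmidt"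
  assumes "0 < \<epsilon>"
  obtains F where "finite F" "F \<subseteq> onb" "norm (G - (\<Sum>e\<in>F. e \<otimes>\<^sub>H blinfun_of_hs G e)) \<le> \<epsilon>"
proof -
  obtain F where F: "finite F" "F \<subseteq> onb"
    "dist (\<Sum>e\<in>F. (norm (blinfun_of_hs G e))\<^sup>2) ((norm G)\<^sup>2) \<le> \<epsilon>\<^sup>2"
    using has_sum_finite_approximation[OF norm_hs_has_sum, of "\<epsilon>\<^sup>2"] assms
    by (metis zero_less_power)
  have "(norm (G - (\<Sum>e\<in>F. e \<otimes>\<^sub>H blinfun_of_hs G e)))\<^sup>2 =
      (norm G)\<^sup>2 - (\<Sum>e\<in>F. (norm (blinfun_of_hs G e))\<^sup>2)"
    using F(1,2) onb_orthonormal by (intro hs_bessel) (auto intro: pairwise_subset)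
  also have "\<dots> \<le> \<epsilon>\<^sup>2" using F(3) by (simp add: dist_real_def)
  finally have "norm (G - (\<Sum>e\<in>F. e \<otimes>\<^sub>H blinfun_of_hs G e)) \<le> \<epsilon>"
    by (rule power2_le_imp_le) (use assms in simp)
  with F(1,2) show ?thesis by (rule that)
qed

text \<open>On the unit ball each coefficient stays in a compact interval, so the image lies in a
  finite Minkowski sum of compact segments. Containment is enough, since only a finite net is wanted
  later.\<close>

lemma finite_rank_image_in_compact:
  fixes g :: "'a::real_inner \<Rightarrow> 'b::real_normed_vector"
  assumes "finite F"
  shows "\<exists>C. compact C \<and> (\<forall>x. norm x \<le> 1 \<longrightarrow> (\<Sum>e\<in>F. (e \<bullet> x) *\<^sub>R g e) \<in> C)"
  using assms
proof induction
  case empty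
  show ?case by (intro exI[of _ "{0}"]) simp
next
  case (insert e F)
  then obtain C where C: "compact C" "\<And>x. norm x \<le> 1 \<Longrightarrow> (\<Sum>e\<in>F. (e \<bullet> x) *\<^sub>R g e) \<in> C" by blast
  let ?D = "(\<lambda>t. t *\<^sub>R g e) ` {- norm e..norm e}"
  have "compact ?D" by (intro compact_continuous_image continuous_intros compact_Icc)
  then have "compact {x + y | x y. x \<in> ?D \<and> y \<in> C}" using C(1) by (rule compact_sums)
  moreover have "(e \<bullet> x) *\<^sub>R g e \<in> ?D" if "norm x \<le> 1" for x
  proof -
    have "\<bar>e \<bullet> x\<bar> \<le> norm e * norm x" by (rule Cauchy_Schwarz_ineq2)
    also have "\<dots> \<le> norm e * 1" using that by (intro mult_left_mono) auto
    finally show ?thesis by (auto simp: abs_le_iff intro!: imageI)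
  qed
  then have "(\<Sum>e\<in>insert e F. (e \<bullet> x) *\<^sub>R g e) \<in> {x + y | x y. x \<in> ?D \<and> y \<in> C}"
    if "norm x \<le> 1" for x
    unfolding sum.insert[OF insert.hyps] using C(2) that by blast
  ultimately show ?case by blast
qed

text \<open>A Hilbert-Schmidt operator is a norm limit of finite-rank operators, so a finite net for
  an approximation, with slightly larger radius, is one for the operator itself.\<close>

lemma compact_closure_hs_image:
  fixes G :: "('a::{real_inner,second_countable_topology}, 'b::{real_inner,complete_space}) hilbert_schmidt"
  shows "compact (closure (blinfun_of_hs G ` cball 0 1))"
  unfolding compact_eq_totally_bounded
proof (intro conjI allI impI)
  show "complete (closure (blinfun_of_hs G ` cball 0 1))" by (simp add: complete_eq_closed)
  fix \<epsilon> :: real assume "0 < \<epsilon>"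
  then obtain F where F: "finite F" "norm (G - (\<Sum>e\<in>F. e \<otimes>\<^sub>H blinfun_of_hs G e)) \<le> \<epsilon> / 4"
    using hs_finite_rank_approx[of "\<epsilon> / 4" G] by auto
  obtain C where C: "compact C"
    "\<And>x. norm x \<le> 1 \<Longrightarrow> (\<Sum>e\<in>F. (e \<bullet> x) *\<^sub>R blinfun_of_hs G e) \<in> C"
    using finite_rank_image_in_compact[OF F(1), of "blinfun_of_hs G"] by blast
  obtain k where k: "finite k" "C \<subseteq> (\<Union>y\<in>k. ball y (\<epsilon> / 4))"
    using C(1) \<open>0 < \<epsilon>\<close> unfolding compact_eq_totally_bounded by (metis divide_pos_pos zero_less_numeral)
  have "blinfun_of_hs G x \<in> (\<Union>y\<in>k. cball y (\<epsilon> / 2))" if x: "norm x \<le> 1" for x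
  proof -
    let ?S = "\<Sum>e\<in>F. (e \<bullet> x) *\<^sub>R blinfun_of_hs G e"
    obtain y where y: "y \<in> k" "dist y ?S < \<epsilon> / 4" using C(2)[OF x] k(2) by auto
    have "norm (blinfun_of_hs G x - ?S) \<le> norm (G - (\<Sum>e\<in>F. e \<otimes>\<^sub>H blinfun_of_hs G e)) * norm x"
      using norm_hs_apply_le[of "G - (\<Sum>e\<in>F. e \<otimes>\<^sub>H blinfun_of_hs G e)" x]
      by (simp add: blinfun_of_hs_diff blinfun_of_hs_sum hs_tensor_apply)
    also have "\<dots> \<le> (\<epsilon> / 4) * 1" using F(2) that \<open>0 < \<epsilon>\<close> by (intro mult_mono) auto
    finally have "dist y (blinfun_of_hs G x) \<le> \<epsilon> / 4 + \<epsilon> / 4"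
      using y(2) dist_triangle[of y "blinfun_of_hs G x" ?S] by (simp add: dist_norm norm_minus_commute)
    then show ?thesis using y(1) by auto
  qed
  then have "blinfun_of_hs G ` cball 0 1 \<subseteq> (\<Union>y\<in>k. cball y (\<epsilon> / 2))" by auto
  \<comment> \<open>Closed balls make the finite union closed, so it absorbs the closure; the slack
    between \<open>\<epsilon> / 2\<close> and \<open>\<epsilon>\<close> returns to open
    balls.\<close>
  then have "closure (blinfun_of_hs G ` cball 0 1) \<subseteq> (\<Union>y\<in>k. cball y (\<epsilon> / 2))"
    using k(1) by (intro closure_minimal closed_UN) auto
  also have "\<dots> \<subseteq> (\<Union>y\<in>k. ball y \<epsilon>)" using \<open>0 < \<epsilon>\<close> by (intro UN_mono) auto
  finally show "\<exists>k. finite k \<and> closure (blinfun_of_hs G ` cball 0 1) \<subseteq> (\<Union>y\<in>k. ball y \<epsilon>)"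
    using k(1) by blast
qed

lemma blinfun_norm_approx:
  fixes T :: "'a::real_normed_vector \<Rightarrow>\<^sub>L 'b::real_normed_vector"
  assumes "c < norm T"
  obtains x where "norm x \<le> 1" "c < norm (T x)"
proof (rule ccontr)
  assume "\<not> thesis"
  then have le: "norm (T x) \<le> c" if "norm x \<le> 1" for x using that \<open>\<And>x. \<lbrakk>norm x \<le> 1; c < norm (T x)\<rbrakk> \<Longrightarrow> thesis\<close> by force
  have "norm T \<le> c"
  proof (rule norm_blinfun_bound)
    show "0 \<le> c" using le[of 0] by simp
    show "norm (T x) \<le> c * norm x" for x
    proof (cases "x = 0")
      case False
      then have "norm (T ((1 / norm x) *\<^sub>R x)) \<le> c" by (intro le) simp
      then show ?thesis using False by (simp add: blinfun.scaleR_right divide_simps)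
    qed simp
  qed
  with assms show False by simp
qed

text \<open>For unit vectors \<open>x\<close> with \<open>norm (G x)\<close> close to \<open>m = norm G\<close>, the vector \<open>G\<^sup>* G x - m\<^sup>2 x\<close>
  is small, so compactness turns a maximizing sequence into an eigenvector.\<close>

lemma hs_singular_vector_exists:
  fixes G :: "('a::{real_inner,complete_space,second_countable_topology},
    'b::{real_inner,complete_space}) hilbert_schmidt"
  assumes "G \<noteq> 0"
  obtains s x where "0 < s" "x \<noteq> 0" "adjoint (blinfun_of_hs G) (blinfun_of_hs G x) = s\<^sup>2 *\<^sub>R x"
proof -
  let ?T = "blinfun_apply (blinfun_of_hs G)"
  define m where "m = norm (blinfun_of_hs G)"
  note adj = inner_adjoint[OF bounded_linear_blinfun_of_hs[of G]]
  have "blinfun_of_hs G \<noteq> 0"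
    using assms blinfun_of_hs_inject zero_hilbert_schmidt.rep_eq by metis
  then have "0 < m" by (simp add: m_def)
  have T_le: "norm (?T x) \<le> m * norm x" for x
    unfolding m_def by (rule norm_blinfun)
  have "\<exists>x. norm x \<le> 1 \<and> m - 1 / real (Suc n) < norm (?T x)" for n
    using blinfun_norm_approx[of "m - 1 / real (Suc n)" "blinfun_of_hs G"] by (auto simp: m_def)
  then obtain X where X: "\<And>n. norm (X n) \<le> 1" "\<And>n. m - 1 / real (Suc n) < norm (?T (X n))"
    by metis
  have "\<forall>n. ?T (X n) \<in> closure (?T ` cball 0 1)"
    using X(1) closure_subset by fastforce
  then obtain y r where r: "strict_mono r" and y: "((\<lambda>n. ?T (X n)) \<circ> r) \<longlonglongrightarrow> y"
    using compact_closure_hs_image[of G] unfolding compact_def by metis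
  define A where "A = adjoint ?T"
  have bl_A: "bounded_linear A" unfolding A_def
    by (intro bounded_linear_adjoint bounded_linear_blinfun_of_hs)
  have A_le: "norm (A z) \<le> m * norm z" for z
  proof (cases "A z = 0")
    case True
    then show ?thesis using \<open>0 < m\<close> by simp
  next
    case False
    have "norm (A z) * norm (A z) = ?T (A z) \<bullet> z"
      by (simp add: A_def dot_square_norm power2_eq_square flip: adj)
    also have "\<dots> \<le> norm (?T (A z)) * norm z" by (rule norm_cauchy_schwarz)
    also have "\<dots> \<le> (m * norm (A z)) * norm z" by (intro mult_right_mono T_le) simp
    finally have "norm (A z) * norm (A z) \<le> norm (A z) * (m * norm z)" by (simp add: mult_ac)
    then show ?thesis using False by simp
  qed
  have norm_T_lim: "(\<lambda>n. norm (?T (X n))) \<longlonglongrightarrow> m"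
  proof (rule tendsto_sandwich)
    have "(\<lambda>n. m - 1 / real (Suc n)) \<longlonglongrightarrow> m - 0"
      by (intro tendsto_intros LIMSEQ_Suc[OF lim_1_over_n])
    then show "(\<lambda>n. m - 1 / real (Suc n)) \<longlonglongrightarrow> m" by simp
    show "(\<lambda>n. m) \<longlonglongrightarrow> m" by simp
    show "\<forall>\<^sub>F n in sequentially. m - 1 / real (Suc n) \<le> norm (?T (X n))"
      using X(2) by (intro always_eventually allI less_imp_le)
    show "\<forall>\<^sub>F n in sequentially. norm (?T (X n)) \<le> m"
    proof (intro always_eventually allI)
      fix n
      have "m * norm (X n) \<le> m * 1" using X(1) \<open>0 < m\<close> by (intro mult_left_mono) auto
      then show "norm (?T (X n)) \<le> m" using T_le[of "X n"] by linarith
    qed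
  qed
  \<comment> \<open>In the expanded square the two outer terms are each at most \<open>m ^ 4\<close>
    and the cross term is \<open>- 2 * m\<^sup>2 * (norm (?T x))\<^sup>2\<close>, so the bound
    vanishes as \<open>norm (?T x)\<close> tends to \<open>m\<close>.\<close>
  have defect: "(norm (A (?T x) - m\<^sup>2 *\<^sub>R x))\<^sup>2 \<le> m\<^sup>2 * (2 * (m\<^sup>2 - (norm (?T x))\<^sup>2))" if "norm x \<le> 1" for x
  proof -
    have AT: "A (?T x) \<bullet> x = (norm (?T x))\<^sup>2"
      by (subst inner_commute) (simp add: A_def adj dot_square_norm)
    have x1: "(norm x)\<^sup>2 \<le> 1" using that by (simp add: power_le_one)
    have "norm (A (?T x)) \<le> m * (m * norm x)"
      using A_le[of "?T x"] mult_left_mono[OF T_le[of x], of m] \<open>0 < m\<close> by linarith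
    then have "(norm (A (?T x)))\<^sup>2 \<le> (m * (m * norm x))\<^sup>2" by (rule power_mono) simp
    also have "\<dots> = m ^ 4 * (norm x)\<^sup>2" by (simp add: power_mult_distrib flip: power_mult)
    also have "\<dots> \<le> m ^ 4 * 1" using x1 by (intro mult_left_mono) auto
    finally have 1: "(norm (A (?T x)))\<^sup>2 \<le> m ^ 4" by simp
    have 2: "m ^ 4 * (norm x)\<^sup>2 \<le> m ^ 4 * 1" using x1 by (intro mult_left_mono) auto
    have "(norm (A (?T x) - m\<^sup>2 *\<^sub>R x))\<^sup>2 =
        (norm (A (?T x)))\<^sup>2 - 2 * m\<^sup>2 * (A (?T x) \<bullet> x) + m ^ 4 * (norm x)\<^sup>2"
      using norm_diff_scaleR[of "A (?T x)" "m\<^sup>2" x] by (simp flip: power_mult)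
    also have "\<dots> \<le> m ^ 4 - 2 * m\<^sup>2 * (norm (?T x))\<^sup>2 + m ^ 4" using 1 2 AT by simp
    also have "\<dots> = m\<^sup>2 * (2 * (m\<^sup>2 - (norm (?T x))\<^sup>2))"
      by (simp add: algebra_simps power4_eq_xxxx power2_eq_square)
    finally show ?thesis .
  qed
  have "(\<lambda>n. m\<^sup>2 * (2 * (m\<^sup>2 - (norm (?T (X n)))\<^sup>2))) \<longlonglongrightarrow> m\<^sup>2 * (2 * (m\<^sup>2 - m\<^sup>2))"
    by (intro tendsto_intros norm_T_lim)
  then have "(\<lambda>n. m\<^sup>2 * (2 * (m\<^sup>2 - (norm (?T (X n)))\<^sup>2))) \<longlonglongrightarrow> 0" by simp
  then have "(\<lambda>n. (norm (A (?T (X n)) - m\<^sup>2 *\<^sub>R X n))\<^sup>2) \<longlonglongrightarrow> 0"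
    by (rule tendsto_sandwich[OF always_eventually always_eventually tendsto_const, rotated 2])
      (intro allI zero_le_power2, intro allI defect X(1))
  then have "(\<lambda>n. norm (A (?T (X n)) - m\<^sup>2 *\<^sub>R X n)) \<longlonglongrightarrow> 0"
    using tendsto_real_sqrt[of _ 0] by fastforce
  then have d0: "(\<lambda>n. A (?T (X n)) - m\<^sup>2 *\<^sub>R X n) \<longlonglongrightarrow> 0"
    by (rule tendsto_norm_zero_cancel)
  note sub = LIMSEQ_subseq_LIMSEQ[OF _ r, unfolded comp_def]
  \<comment> \<open>Compactness controls only the images of \<open>X\<close>. Convergence of
    \<open>X\<close> along \<open>r\<close> is regained by writing
    \<open>m\<^sup>2 *\<^sub>R X\<close> as the convergent \<open>A (?T X)\<close> minus the
    vanishing defect.\<close>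
  have "(\<lambda>n. A (?T (X (r n)))) \<longlonglongrightarrow> A y"
    using y by (intro bounded_linear.tendsto[OF bl_A]) (simp add: comp_def)
  then have "(\<lambda>n. A (?T (X (r n))) - (A (?T (X (r n))) - m\<^sup>2 *\<^sub>R X (r n))) \<longlonglongrightarrow> A y - 0"
    by (intro tendsto_diff sub[OF d0])
  then have "(\<lambda>n. (1 / m\<^sup>2) *\<^sub>R (m\<^sup>2 *\<^sub>R X (r n))) \<longlonglongrightarrow> (1 / m\<^sup>2) *\<^sub>R A y"
    by (intro tendsto_intros) simp
  then have "(\<lambda>n. X (r n)) \<longlonglongrightarrow> (1 / m\<^sup>2) *\<^sub>R A y" using \<open>0 < m\<close> by simp
  then obtain x where x: "(\<lambda>n. X (r n)) \<longlonglongrightarrow> x" by blast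
  have Tx: "(\<lambda>n. ?T (X (r n))) \<longlonglongrightarrow> ?T x"
    by (intro bounded_linear.tendsto[OF bounded_linear_blinfun_of_hs] x)
  \<comment> \<open>The vectors \<open>X n\<close> are not normalized, so \<open>x\<close> is shown
    to be nonzero through its image.\<close>
  have "norm (?T x) = m"
    using LIMSEQ_unique[OF tendsto_norm[OF Tx] sub[OF norm_T_lim]] .
  then have "x \<noteq> 0" using \<open>0 < m\<close> by auto
  moreover have "(\<lambda>n. A (?T (X (r n))) - m\<^sup>2 *\<^sub>R X (r n)) \<longlonglongrightarrow> A (?T x) - m\<^sup>2 *\<^sub>R x"
    by (intro tendsto_intros bounded_linear.tendsto[OF bl_A] Tx x)
  then have "A (?T x) - m\<^sup>2 *\<^sub>R x = 0" using sub[OF d0] LIMSEQ_unique by blast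
  ultimately show ?thesis using \<open>0 < m\<close> by (intro that[of m x]) (auto simp: A_def)
qed

text \<open>The cardinality bound stands in for finite dimension: an orthonormal set in
  \<open>V\<close> of largest size must span \<open>V\<close>, since a missing vector, made
  orthogonal to it and normalized, would enlarge it.\<close>

lemma subspace_orthonormal_basis:
  fixes V :: "'a::real_inner set"
  assumes "subspace V"
    and bound: "\<And>C. \<lbrakk>finite C; C \<subseteq> V; pairwise orthogonal C; \<forall>e\<in>C. norm e = 1\<rbrakk> \<Longrightarrow> card C \<le> N"
  obtains C where "finite C" "C \<subseteq> V" "pairwise orthogonal C" "\<forall>e\<in>C. norm e = 1"
    "span C = V" "card C = dim V"
proof -
  let ?P = "\<lambda>C. finite C \<and> C \<subseteq> V \<and> pairwise orthogonal C \<and> (\<forall>e\<in>C. norm e = 1)"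
  have "\<exists>C. ?P C \<and> (\<forall>D. ?P D \<longrightarrow> card D \<le> card C)"
    by (rule ex_has_greatest_nat[of ?P "{}" card "Suc N"]) (use bound in \<open>auto simp: less_Suc_eq_le\<close>)
  then obtain C where C: "?P C" and max: "\<And>D. ?P D \<Longrightarrow> card D \<le> card C" by blast
  have "x \<in> span C" if "x \<in> V" for x
  proof (rule ccontr)
    assume x: "x \<notin> span C"
    let ?p = "\<Sum>e\<in>C. (x \<bullet> e) *\<^sub>R e"
    define y where "y = x - ?p"
    have p: "?p \<in> span C" by (intro span_sum span_scale span_base)
    then have "y \<noteq> 0" using x by (auto simp: y_def)
    have "?p \<in> V" using p C \<open>subspace V\<close> by (metis span_minimal subset_iff)
    then have "y \<in> V" unfolding y_def using that \<open>subspace V\<close> by (intro subspace_diff)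
    have ye: "y \<bullet> e = 0" if "e \<in> C" for e
    proof -
      have "?p \<bullet> e = (\<Sum>e'\<in>C. if e' = e then x \<bullet> e else 0)"
        unfolding inner_sum_left using C that
        by (intro sum.cong) (auto simp: pairwise_def orthogonal_def norm_eq_1)
      then show ?thesis using C that by (simp add: y_def inner_diff_left)
    qed
    let ?n = "(1 / norm y) *\<^sub>R y"
    have "?n \<notin> C" using ye[of ?n] \<open>y \<noteq> 0\<close> by auto
    have "?P (insert ?n C)"
      using C ye \<open>y \<noteq> 0\<close> \<open>y \<in> V\<close> \<open>subspace V\<close>
      by (auto simp: pairwise_insert orthogonal_def inner_commute intro: subspace_scale)
    from max[OF this] show False using \<open>?n \<notin> C\<close> C by simp
  qed
  then have span: "span C = V" using C \<open>subspace V\<close> by (auto intro: span_minimal[THEN subsetD])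
  have "independent C" using C by (intro pairwise_orthogonal_independent) auto
  then have "card C = dim V" using span dim_span_eq_card_independent by metis
  then show ?thesis using C span by (intro that[of C]) auto
qed

section \<open>Series over orthonormal systems and the singular value decomposition\<close>

lemma hs_summable_orthonormal:
  fixes G :: "('a::{real_inner,second_countable_topology}, 'b::real_inner) hilbert_schmidt"
  assumes "pairwise orthogonal A" "\<forall>a\<in>A. norm a = 1"
  shows "(\<lambda>a. (norm (blinfun_of_hs G a))\<^sup>2) summable_on A"
proof (rule nonneg_bdd_above_summable_on)
  show "bdd_above (sum (\<lambda>a. (norm (blinfun_of_hs G a))\<^sup>2) ` {F. F \<subseteq> A \<and> finite F})"
    using assms by (intro bdd_aboveI[of _ "(norm G)\<^sup>2"])
      (auto intro!: hs_bessel_le intro: pairwise_subset)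
qed simp

text \<open>Cauchy-Schwarz for each vector, then for the sum, then Bessel. The bound does not depend
  on \<open>F\<close>, so it carries over to infinite families.\<close>

lemma hs_sum_inner_le:
  fixes G X :: "('a::{real_inner,second_countable_topology}, 'b::real_inner) hilbert_schmidt"
  assumes "finite F" "pairwise orthogonal F" "\<forall>a\<in>F. norm a = 1"
  shows "(\<Sum>a\<in>F. blinfun_of_hs G a \<bullet> blinfun_of_hs X a) \<le> norm G * norm X"
proof -
  have L2: "L2_set (\<lambda>a. norm (blinfun_of_hs Y a)) F \<le> norm Y" for Y :: "('a, 'b) hilbert_schmidt"
    unfolding L2_set_def using hs_bessel_le[OF assms, of Y] by (intro real_le_lsqrt) (auto simp: sum_nonneg)
  have "(\<Sum>a\<in>F. blinfun_of_hs G a \<bullet> blinfun_of_hs X a) \<le>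
      (\<Sum>a\<in>F. \<bar>norm (blinfun_of_hs G a)\<bar> * \<bar>norm (blinfun_of_hs X a)\<bar>)"
    by (intro sum_mono) (simp add: norm_cauchy_schwarz)
  also have "\<dots> \<le> L2_set (\<lambda>a. norm (blinfun_of_hs G a)) F * L2_set (\<lambda>a. norm (blinfun_of_hs X a)) F"
    by (rule L2_set_mult_ineq)
  also have "\<dots> \<le> norm G * norm X" by (intro mult_mono L2) (auto simp: L2_set_nonneg)
  finally show ?thesis .
qed

text \<open>The operator \<open>K\<close> below is \<open>\<Sum>a\<in>A. a \<otimes>\<^sub>H G a\<close>, obtained by the Riesz theorem rather than as
  a limit.\<close>

lemma hs_restrict_orthonormal:
  fixes G :: "('a::{real_inner,second_countable_topology}, 'b::{real_inner,complete_space}) hilbert_schmidt"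
  assumes A: "pairwise orthogonal A" "\<forall>a\<in>A. norm a = 1"
  obtains K where
    "\<And>X. ((\<lambda>a. blinfun_of_hs G a \<bullet> blinfun_of_hs X a) has_sum (K \<bullet> X)) A"
proof -
  define f where "f X = (\<Sum>\<^sub>\<infinity>a\<in>A. blinfun_of_hs G a \<bullet> blinfun_of_hs X a)"
    for X :: "('a, 'b) hilbert_schmidt"
  have summable: "(\<lambda>a. blinfun_of_hs G a \<bullet> blinfun_of_hs X a) summable_on A"
    for X :: "('a, 'b) hilbert_schmidt"
    by (intro hs_summable_inner hs_summable_orthonormal A)
  have add: "f (X + Y) = f X + f Y" for X Y
    by (simp add: f_def blinfun_of_hs_add inner_add_right infsum_add summable)
  have scale: "f (c *\<^sub>R X) = c *\<^sub>R f X" for c X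
    by (simp add: f_def blinfun_of_hs_scaleR infsum_cmult_right')
  have le: "f X \<le> norm G * norm X" for X
    unfolding f_def using A
    by (intro infsum_le_finite_sums summable hs_sum_inner_le) (auto intro: pairwise_subset)
  have "\<bar>f X\<bar> \<le> norm X * norm G" for X
    using le[of X] le[of "(-1) *\<^sub>R X"] scale[of "-1" X] by (simp add: abs_le_iff mult.commute)
  then have "bounded_linear f"
    by (intro bounded_linear_intro[of _ "norm G"]) (simp_all only: add scale real_norm_def)
  then obtain K where K: "\<And>X. f X = K \<bullet> X" by (rule riesz_representation) blast
  have "((\<lambda>a. blinfun_of_hs G a \<bullet> blinfun_of_hs X a) has_sum (K \<bullet> X)) A" for X
    using has_sum_infsum[OF summable[of X]] K[of X] by (simp add: f_def)
  then show ?thesis by (rule that)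
qed

text \<open>Unit vectors \<open>a\<close> of the eigenspace satisfy \<open>norm (G a) = s\<close>,
  so by Bessel an orthonormal set in it has at most \<open>(norm G)\<^sup>2 / s\<^sup>2\<close>
  elements. Hence \<open>dim\<close> counts a genuine basis.\<close>

lemma singular_multiplicity_basis:
  fixes G :: "('a::{real_inner,complete_space,second_countable_topology},
    'b::{real_inner,complete_space,second_countable_topology}) hilbert_schmidt"
  assumes "0 < s"
  obtains C where "finite C" "pairwise orthogonal C" "\<forall>e\<in>C. norm e = 1"
    "span C = {x. adjoint (blinfun_of_hs G) (blinfun_of_hs G x) = s\<^sup>2 *\<^sub>R x}"
    "card C = singular_multiplicity G s"
proof -
  let ?T = "blinfun_apply (blinfun_of_hs G)"
  let ?E = "{x. adjoint ?T (?T x) = s\<^sup>2 *\<^sub>R x}"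
  note adj = inner_adjoint[OF bounded_linear_blinfun_of_hs[of G]]
  interpret adj: bounded_linear "adjoint ?T"
    by (intro bounded_linear_adjoint bounded_linear_blinfun_of_hs)
  have "subspace ?E"
    by (auto simp: subspace_def blinfun.add_right blinfun.scaleR_right adj.add adj.scale
        algebra_simps)
  moreover have "card C \<le> nat \<lfloor>(norm G)\<^sup>2 / s\<^sup>2\<rfloor>"
    if C: "finite C" "C \<subseteq> ?E" "pairwise orthogonal C" "\<forall>e\<in>C. norm e = 1" for C
  proof -
    have "(norm (?T a))\<^sup>2 = s\<^sup>2" if "a \<in> C" for a
    proof -
      have "(norm (?T a))\<^sup>2 = a \<bullet> adjoint ?T (?T a)" by (simp add: adj dot_square_norm)
      also have "\<dots> = s\<^sup>2" using C that by (auto simp: dot_square_norm)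
      finally show ?thesis .
    qed
    then have "real (card C) * s\<^sup>2 \<le> (norm G)\<^sup>2" using hs_bessel_le[OF C(1,3,4), of G] by simp
    then show ?thesis using \<open>0 < s\<close> by (intro le_nat_floor) (simp add: pos_le_divide_eq)
  qed
  ultimately obtain C where "finite C" "pairwise orthogonal C" "\<forall>e\<in>C. norm e = 1"
    "span C = ?E" "card C = dim ?E"
    by (rule subspace_orthonormal_basis) auto
  then show ?thesis by (intro that[of C]) (auto simp: singular_multiplicity_def)
qed

text \<open>\<open>A\<close> collects orthonormal bases of all eigenspaces of \<open>G\<^sup>* G\<close> to positive eigenvalues. If \<open>G\<close>
  differed from \<open>\<Sum>a\<in>A. a \<otimes>\<^sub>H G a\<close>, a singular vector of the difference would be an eigenvector of
  \<open>G\<^sup>* G\<close> orthogonal to \<open>A\<close>.\<close>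

lemma singular_value_decomposition:
  fixes G :: "('a::{real_inner,complete_space,second_countable_topology},
    'b::{real_inner,complete_space,second_countable_topology}) hilbert_schmidt"
  obtains A where "pairwise orthogonal A" "\<And>a. a \<in> A \<Longrightarrow> norm a = 1"
    "\<And>a. a \<in> A \<Longrightarrow> blinfun_of_hs G a \<noteq> 0"
    "\<And>X. ((\<lambda>a. blinfun_of_hs G a \<bullet> blinfun_of_hs X a) has_sum (G \<bullet> X)) A"
    "\<And>F. \<lbrakk>finite F; F \<subseteq> A\<rbrakk> \<Longrightarrow> (\<Sum>a\<in>F. ennreal (norm (blinfun_of_hs G a))) \<le> nuclear_norm G"
proof -
  let ?T = "blinfun_apply (blinfun_of_hs G)"
  define E where "E s = {x. adjoint ?T (?T x) = s\<^sup>2 *\<^sub>R x}" for s :: real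
  note adj = inner_adjoint[OF bounded_linear_blinfun_of_hs]
  have "\<exists>C. finite C \<and> pairwise orthogonal C \<and> (\<forall>e\<in>C. norm e = 1) \<and> span C = E s \<and>
      card C = singular_multiplicity G s" if "0 < s" for s
    using singular_multiplicity_basis[OF that, of G] unfolding E_def by metis
  then obtain B where B: "\<And>s. 0 < s \<Longrightarrow> finite (B s) \<and> pairwise orthogonal (B s) \<and>
      (\<forall>e\<in>B s. norm e = 1) \<and> span (B s) = E s \<and> card (B s) = singular_multiplicity G s"
    by metis
  define A where "A = (\<Union>s\<in>{0<..}. B s)"
  have eigen: "?T x \<bullet> ?T y = s\<^sup>2 * (x \<bullet> y)" if "x \<in> E s" for x y s
    using that adj[of y G "?T x"] by (simp add: E_def inner_commute)
  have BE: "a \<in> E s" if "0 < s" "a \<in> B s" for a s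
    using B[OF that(1)] that(2) span_base by blast
  have norm_T: "norm (?T a) = s" if "0 < s" "a \<in> B s" for a s
  proof -
    have "(norm (?T a))\<^sup>2 = s\<^sup>2"
      using eigen[OF BE[OF that], of a] B[OF that(1)] that(2) by (simp add: dot_square_norm)
    then show ?thesis using \<open>0 < s\<close> by (simp add: power2_eq_iff_nonneg)
  qed
  have A_B: "a \<in> B (norm (?T a)) \<and> 0 < norm (?T a)" if a: "a \<in> A" for a
  proof -
    obtain s where "0 < s" "a \<in> B s" using a by (auto simp: A_def)
    then show ?thesis using norm_T by simp
  qed
  then have A_E: "a \<in> E (norm (?T a))" if "a \<in> A" for a using BE that by simp
  have unit: "norm a = 1" if "a \<in> A" for a
    using A_B[OF that] B[of "norm (?T a)"] by blast
  have orth: "pairwise orthogonal A"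
  proof (rule pairwiseI)
    fix a b assume ab: "a \<in> A" "b \<in> A" "a \<noteq> b"
    show "orthogonal a b"
    proof (cases "norm (?T a) = norm (?T b)")
      case True
      then have "a \<in> B (norm (?T a))" "b \<in> B (norm (?T a))" "0 < norm (?T a)"
        using A_B[OF ab(1)] A_B[OF ab(2)] by simp_all
      then show ?thesis using B[of "norm (?T a)"] ab(3)
        by (intro pairwiseD[of orthogonal "B (norm (?T a))"]) simp_all
    next
      case False
      have "(norm (?T a))\<^sup>2 * (a \<bullet> b) = (norm (?T b))\<^sup>2 * (a \<bullet> b)"
        using eigen[OF A_E[OF ab(1)], of b] eigen[OF A_E[OF ab(2)], of a]
        by (simp only: inner_commute[of b a] inner_commute[of "?T b" "?T a"])
      then show ?thesis using False by (simp add: orthogonal_def power2_eq_iff_nonneg)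
    qed
  qed
  obtain K where K: "\<And>X. ((\<lambda>a. ?T a \<bullet> blinfun_of_hs X a) has_sum (K \<bullet> X)) A"
    using hs_restrict_orthonormal[OF orth] unit by blast
  \<comment> \<open>By orthonormality, testing against \<open>x \<otimes>\<^sub>H b\<close> leaves
    the single term at \<open>x\<close> of the series defining \<open>K\<close>.\<close>
  have K_A: "blinfun_of_hs K x = ?T x" if "x \<in> A" for x
  proof -
    have "blinfun_of_hs K x \<bullet> b = ?T x \<bullet> b" for b
    proof -
      have "((\<lambda>a. ?T a \<bullet> blinfun_of_hs (x \<otimes>\<^sub>H b) a) has_sum (?T x \<bullet> b)) A"
        using that unit[OF that] pairwiseD[OF orth that]
        by (intro has_sum_finite_neutralI[of "{x}"])
          (auto simp: hs_tensor_apply norm_eq_1 orthogonal_def)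
      from has_sum_unique[OF K this] show ?thesis by (simp add: inner_hs_tensor)
    qed
    then show ?thesis using vector_eq_rdot by blast
  qed
  have K_orth: "blinfun_of_hs K x = 0" if "\<And>a. a \<in> A \<Longrightarrow> x \<bullet> a = 0" for x
  proof -
    have "((\<lambda>a. ?T a \<bullet> blinfun_of_hs (x \<otimes>\<^sub>H blinfun_of_hs K x) a) has_sum 0) A"
      by (rule has_sum_0) (simp add: hs_tensor_apply that)
    from has_sum_unique[OF K this] show ?thesis by (simp add: inner_hs_tensor)
  qed
  have "G - K = 0"
  proof (rule ccontr)
    assume "G - K \<noteq> 0"
    then obtain r x where r: "0 < r" "x \<noteq> 0"
      and x: "adjoint (blinfun_of_hs (G - K)) (blinfun_of_hs (G - K) x) = r\<^sup>2 *\<^sub>R x"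
      by (rule hs_singular_vector_exists)
    have R: "blinfun_of_hs (G - K) x \<bullet> blinfun_of_hs (G - K) y = r\<^sup>2 * (x \<bullet> y)" for y
      using adj[of y "G - K" "blinfun_of_hs (G - K) x"] x by (simp add: inner_commute)
    \<comment> \<open>\<open>G - K\<close> vanishes on \<open>A\<close>, so \<open>R\<close> at
      \<open>a\<close> reads \<open>0 = r\<^sup>2 * (x \<bullet> a)\<close>.\<close>
    have x_A: "x \<bullet> a = 0" if "a \<in> A" for a
      using R[of a] K_A[OF that] \<open>0 < r\<close> by (simp add: blinfun_of_hs_diff)
    \<comment> \<open>Since \<open>x\<close> is orthogonal to \<open>A\<close>,
      \<open>K x = 0\<close>, and \<open>?T x\<close> is orthogonal to every \<open>?T a\<close>,
      hence to the range of \<open>K\<close>. Both occurrences of \<open>K\<close> therefore drop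
      out of \<open>R\<close>, leaving the eigenvalue equation for \<open>G\<close> alone.\<close>
    have "y \<bullet> adjoint ?T (?T x) = y \<bullet> (r\<^sup>2 *\<^sub>R x)" for y
    proof -
      have "((\<lambda>a. ?T a \<bullet> blinfun_of_hs (y \<otimes>\<^sub>H ?T x) a) has_sum 0) A"
      proof (rule has_sum_0)
        fix a assume "a \<in> A"
        then have "?T a \<bullet> ?T x = 0" using eigen[OF A_E, of a x] x_A[of a] by (simp add: inner_commute)
        then show "?T a \<bullet> blinfun_of_hs (y \<otimes>\<^sub>H ?T x) a = 0" by (simp add: hs_tensor_apply)
      qed
      from has_sum_unique[OF K this] have "blinfun_of_hs K y \<bullet> ?T x = 0"
        by (simp add: inner_hs_tensor)
      then have "?T x \<bullet> ?T y = r\<^sup>2 * (x \<bullet> y)"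
        using R[of y] K_orth[OF x_A] by (simp add: blinfun_of_hs_diff inner_diff_right inner_commute)
      then show ?thesis by (simp add: adj inner_commute)
    qed
    then have "adjoint ?T (?T x) = r\<^sup>2 *\<^sub>R x" using vector_eq_ldot by blast
    then have "x \<in> span (B r)" using B[OF \<open>0 < r\<close>] by (simp add: E_def)
    moreover have "orthogonal x a" if "a \<in> B r" for a
      using x_A that \<open>0 < r\<close> by (auto simp: A_def orthogonal_def)
    ultimately have "orthogonal x x" using orthogonal_to_span by blast
    then show False using \<open>x \<noteq> 0\<close> by (simp add: orthogonal_def)
  qed
  then have sums: "((\<lambda>a. ?T a \<bullet> blinfun_of_hs X a) has_sum (G \<bullet> X)) A" for X
    using K[of X] by simp
  have bound: "(\<Sum>a\<in>F. ennreal (norm (?T a))) \<le> nuclear_norm G" if F: "finite F" "F \<subseteq> A" for F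
  proof -
    let ?S = "(\<lambda>a. norm (?T a)) ` F"
    \<comment> \<open>Grouping by singular value: each fibre lies in \<open>B s\<close>, so its size
      is at most the multiplicity of \<open>s\<close>.\<close>
    have "(\<Sum>a\<in>F. ennreal (norm (?T a))) = (\<Sum>s\<in>?S. \<Sum>a\<in>{a \<in> F. norm (?T a) = s}. ennreal (norm (?T a)))"
      using F(1) by (rule sum.image_gen)
    also have "\<dots> \<le> (\<Sum>s\<in>?S. of_nat (singular_multiplicity G s) * ennreal s)"
    proof (rule sum_mono)
      fix s assume "s \<in> ?S"
      then have "0 < s" using A_B F(2) by auto
      have "card {a \<in> F. norm (?T a) = s} \<le> card (B s)"
        using B[OF \<open>0 < s\<close>] A_B F(2) by (intro card_mono) auto
      then have "card {a \<in> F. norm (?T a) = s} \<le> singular_multiplicity G s"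
        using B[OF \<open>0 < s\<close>] by simp
      then show "(\<Sum>a\<in>{a \<in> F. norm (?T a) = s}. ennreal (norm (?T a))) \<le>
          of_nat (singular_multiplicity G s) * ennreal s"
        by (simp add: mult_right_mono)
    qed
    also have "\<dots> \<le> nuclear_norm G"
    proof -
      have "?S \<subseteq> {0<..}" using A_B F(2) by auto
      then have "infsum (\<lambda>s. of_nat (singular_multiplicity G s) * ennreal s) ?S \<le> nuclear_norm G"
        unfolding nuclear_norm_def by (intro infsum_mono_neutral nonneg_summable_on_complete) auto
      then show ?thesis using F(1) by simp
    qed
    finally show ?thesis .
  qed
  have nz: "blinfun_of_hs G a \<noteq> 0" if "a \<in> A" for a using A_B[OF that] by auto
  show ?thesis by (rule that[OF orth unit nz sums bound])
qed

section \<open>Duality between the nuclear norm and the operator norm\<close>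

text \<open>Both parts use one series of nonnegative gaps between \<open>norm (G a)\<close> and its
  pairing with \<open>H a\<close>. Its total is at most \<open>t - H \<bullet> G\<close>; if that is
  not positive, every single gap is zero.\<close>

lemma inner_le_nuclear_norm:
  fixes G H :: "('a::{real_inner,complete_space,second_countable_topology},
    'b::{real_inner,complete_space,second_countable_topology}) hilbert_schmidt"
  assumes H: "\<And>x. norm (blinfun_of_hs H x) \<le> norm x"
    and t: "nuclear_norm G = ennreal t" "0 \<le> t"
  shows "H \<bullet> G \<le> t"
    and "t \<le> H \<bullet> G \<Longrightarrow> \<exists>A. pairwise orthogonal A \<and> (\<forall>a\<in>A. norm a = 1) \<and>
      (\<forall>a\<in>A. blinfun_of_hs G a \<noteq> 0 \<and> blinfun_of_hs G a \<bullet> blinfun_of_hs H a = norm (blinfun_of_hs G a)) \<and>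
      (\<forall>X. ((\<lambda>a. blinfun_of_hs G a \<bullet> blinfun_of_hs X a) has_sum (G \<bullet> X)) A)"
proof -
  obtain A where A: "pairwise orthogonal A" "\<And>a. a \<in> A \<Longrightarrow> norm a = 1"
    "\<And>a. a \<in> A \<Longrightarrow> blinfun_of_hs G a \<noteq> 0"
    and sums: "\<And>X. ((\<lambda>a. blinfun_of_hs G a \<bullet> blinfun_of_hs X a) has_sum (G \<bullet> X)) A"
    and nuc: "\<And>F. \<lbrakk>finite F; F \<subseteq> A\<rbrakk> \<Longrightarrow> (\<Sum>a\<in>F. ennreal (norm (blinfun_of_hs G a))) \<le> nuclear_norm G"
    by (rule singular_value_decomposition[of G]) (rule that; blast)
  have sum_le: "(\<Sum>a\<in>F. norm (blinfun_of_hs G a)) \<le> t" if "finite F" "F \<subseteq> A" for F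
    using nuc[OF that] t by (simp add: sum_ennreal)
  have le: "blinfun_of_hs G a \<bullet> blinfun_of_hs H a \<le> norm (blinfun_of_hs G a)" if "a \<in> A" for a
  proof -
    have "blinfun_of_hs G a \<bullet> blinfun_of_hs H a \<le> norm (blinfun_of_hs G a) * norm (blinfun_of_hs H a)"
      by (rule norm_cauchy_schwarz)
    also have "\<dots> \<le> norm (blinfun_of_hs G a) * 1"
      using H[of a] A(2)[OF that] by (intro mult_left_mono) auto
    finally show ?thesis by simp
  qed
  have "(\<lambda>a. norm (blinfun_of_hs G a)) summable_on A"
    using sum_le by (intro nonneg_bdd_above_summable_on bdd_aboveI[of _ t]) auto
  then obtain S where S: "((\<lambda>a. norm (blinfun_of_hs G a)) has_sum S) A"
    by (auto simp: summable_on_def)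
  have "S \<le> t" using has_sum_le_finite_sums[OF S] sum_le by blast
  have D: "((\<lambda>a. norm (blinfun_of_hs G a) + - (blinfun_of_hs G a \<bullet> blinfun_of_hs H a))
      has_sum (S + - (G \<bullet> H))) A"
    by (intro has_sum_add S has_sum_uminusI sums)
  have "0 \<le> S + - (G \<bullet> H)" using D by (rule has_sum_nonneg) (use le in auto)
  then show "H \<bullet> G \<le> t" using \<open>S \<le> t\<close> by (simp add: inner_commute)
  assume "t \<le> H \<bullet> G"
  then have "S + - (G \<bullet> H) \<le> 0" using \<open>S \<le> t\<close> by (simp add: inner_commute)
  then have "norm (blinfun_of_hs G a) + - (blinfun_of_hs G a \<bullet> blinfun_of_hs H a) = 0"
    if "a \<in> A" for a
    using that by (intro nonneg_has_sum_le_0D[OF D]) (use le in auto)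
  then show "\<exists>A. pairwise orthogonal A \<and> (\<forall>a\<in>A. norm a = 1) \<and>
      (\<forall>a\<in>A. blinfun_of_hs G a \<noteq> 0 \<and> blinfun_of_hs G a \<bullet> blinfun_of_hs H a = norm (blinfun_of_hs G a)) \<and>
      (\<forall>X. ((\<lambda>a. blinfun_of_hs G a \<bullet> blinfun_of_hs X a) has_sum (G \<bullet> X)) A)"
    using A sums by (intro exI[of _ A]) auto
qed

section \<open>The equality case for a single certificate\<close>

locale nuclear_certificate =
  fixes u :: "'a::{real_inner,complete_space,second_countable_topology}"
    and v :: "'b::{real_inner,complete_space,second_countable_topology}"
    and W :: "('a, 'b) hilbert_schmidt"
  assumes u: "norm u = 1" and v: "norm v = 1"
    and Wu: "blinfun_of_hs W u = 0"
    and Wv: "adjoint (blinfun_of_hs W) v = 0"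
    and W: "norm (blinfun_of_hs W) < 1"
begin

abbreviation "H \<equiv> u \<otimes>\<^sub>H v + W"

lemma H_apply: "blinfun_of_hs H x = (u \<bullet> x) *\<^sub>R v + blinfun_of_hs W x"
  by (simp add: blinfun_of_hs_add hs_tensor_apply)

lemma norm_complement: "(norm (x - (u \<bullet> x) *\<^sub>R u))\<^sup>2 = (norm x)\<^sup>2 - (u \<bullet> x)\<^sup>2"
  unfolding norm_diff_scaleR by (simp add: u inner_commute power2_eq_square)

text \<open>\<open>W\<close> kills \<open>u\<close>, so it sees only the part of \<open>x\<close>
  orthogonal to \<open>u\<close>; its adjoint kills \<open>v\<close>, so its values are orthogonal
  to \<open>v\<close>. Pythagoras then applies on both sides.\<close>

lemma norm_H:
  "(norm (blinfun_of_hs H x))\<^sup>2 \<le> (u \<bullet> x)\<^sup>2 + (norm (blinfun_of_hs W))\<^sup>2 * ((norm x)\<^sup>2 - (u \<bullet> x)\<^sup>2)"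
proof -
  have "blinfun_of_hs W x = blinfun_of_hs W (x - (u \<bullet> x) *\<^sub>R u)"
    by (simp add: blinfun.diff_right blinfun.scaleR_right Wu)
  then have "norm (blinfun_of_hs W x) \<le> norm (blinfun_of_hs W) * norm (x - (u \<bullet> x) *\<^sub>R u)"
    using norm_blinfun[of "blinfun_of_hs W" "x - (u \<bullet> x) *\<^sub>R u"] by simp
  then have "(norm (blinfun_of_hs W x))\<^sup>2 \<le> (norm (blinfun_of_hs W) * norm (x - (u \<bullet> x) *\<^sub>R u))\<^sup>2"
    by (rule power_mono) simp
  moreover have "blinfun_of_hs W x \<bullet> v = 0"
    using inner_adjoint[OF bounded_linear_blinfun_of_hs, of x W v] Wv by simp
  then have "(norm (blinfun_of_hs H x))\<^sup>2 = (u \<bullet> x)\<^sup>2 + (norm (blinfun_of_hs W x))\<^sup>2"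
    using v unfolding H_apply power2_norm_eq_inner
    by (simp add: inner_add_left inner_add_right inner_commute norm_eq_1 power2_eq_square)
  ultimately show ?thesis by (simp add: power_mult_distrib norm_complement)
qed

lemma complement_nonneg: "0 \<le> (norm x)\<^sup>2 - (u \<bullet> x)\<^sup>2"
  unfolding norm_complement[symmetric] by simp

lemma W_sq: "(norm (blinfun_of_hs W))\<^sup>2 < 1"
  using W by (simp add: power_less_one_iff abs_square_less_1)

lemma norm_H_le: "norm (blinfun_of_hs H x) \<le> norm x"
proof (rule power2_le_imp_le)
  have "(norm (blinfun_of_hs W))\<^sup>2 * ((norm x)\<^sup>2 - (u \<bullet> x)\<^sup>2) \<le> 1 * ((norm x)\<^sup>2 - (u \<bullet> x)\<^sup>2)"
    using W_sq complement_nonneg by (intro mult_right_mono) auto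
  then show "(norm (blinfun_of_hs H x))\<^sup>2 \<le> (norm x)\<^sup>2" using norm_H[of x] by argo
qed simp

text \<open>For unit \<open>x\<close>, \<open>norm_H\<close> rearranges to a product of
  \<open>1 - (norm W)\<^sup>2\<close> and \<open>1 - (u \<bullet> x)\<^sup>2\<close> being at most
  0. Non-degeneracy makes the first factor positive.\<close>

lemma norm_H_eq:
  assumes "norm x = 1" "1 \<le> norm (blinfun_of_hs H x)"
  shows "x = (u \<bullet> x) *\<^sub>R u" "(u \<bullet> x)\<^sup>2 = 1"
proof -
  have "1 \<le> (norm (blinfun_of_hs H x))\<^sup>2" using assms(2) by (rule one_le_power)
  then have "(1 - (norm (blinfun_of_hs W))\<^sup>2) * (1 - (u \<bullet> x)\<^sup>2) \<le> 0"
    using norm_H[of x] assms(1) by (simp add: algebra_simps)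
  then have "1 - (u \<bullet> x)\<^sup>2 \<le> 0" using W_sq by (simp add: mult_le_0_iff)
  then show *: "(u \<bullet> x)\<^sup>2 = 1" using complement_nonneg[of x] assms(1) by simp
  show "x = (u \<bullet> x) *\<^sub>R u" using norm_complement[of x] * assms(1) by simp
qed

lemma inner_H_tensor: "H \<bullet> (c *\<^sub>R (u \<otimes>\<^sub>H v)) = c"
  using u v by (simp add: inner_hs_tensor H_apply Wu inner_add_left norm_eq_1)

text \<open>The singular vectors are pairwise orthogonal yet all multiples of \<open>u\<close>, so
  there is at most one, and \<open>G\<close> has rank at most one. The equality in the pairing then
  identifies its left singular direction as \<open>v\<close> up to the same sign.\<close>

lemma nuclear_norm_attained:
  assumes t: "nuclear_norm G = ennreal t" "0 \<le> t" and "t \<le> H \<bullet> G"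
  shows "\<exists>\<alpha>\<ge>0. G = \<alpha> *\<^sub>R (u \<otimes>\<^sub>H v)"
proof -
  obtain A where A: "pairwise orthogonal A" "\<And>a. a \<in> A \<Longrightarrow> norm a = 1"
    "\<And>a. a \<in> A \<Longrightarrow> blinfun_of_hs G a \<noteq> 0"
    and eq: "\<And>a. a \<in> A \<Longrightarrow> blinfun_of_hs G a \<bullet> blinfun_of_hs H a = norm (blinfun_of_hs G a)"
    and sums: "\<And>X. ((\<lambda>a. blinfun_of_hs G a \<bullet> blinfun_of_hs X a) has_sum (G \<bullet> X)) A"
    using inner_le_nuclear_norm(2)[OF norm_H_le t assms(3)] by blast
  have a: "a = (u \<bullet> a) *\<^sub>R u" "(u \<bullet> a)\<^sup>2 = 1" if "a \<in> A" for a
  proof -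
    have "norm (blinfun_of_hs G a) * 1 \<le> norm (blinfun_of_hs G a) * norm (blinfun_of_hs H a)"
      using norm_cauchy_schwarz[of "blinfun_of_hs G a" "blinfun_of_hs H a"] eq[OF that] by simp
    then have "1 \<le> norm (blinfun_of_hs H a)" using A(3)[OF that] by simp
    then show "a = (u \<bullet> a) *\<^sub>R u" "(u \<bullet> a)\<^sup>2 = 1" using norm_H_eq A(2)[OF that] by blast+
  qed
  show ?thesis
  proof (cases "A = {}")
    case True
    then have "G \<bullet> G = 0" using sums[of G] has_sum_unique has_sum_empty by blast
    then show ?thesis by (intro exI[of _ 0]) simp
  next
    case False
    then obtain a where "a \<in> A" by blast
    define c where "c = u \<bullet> a"
    define g where "g = blinfun_of_hs G a"
    have c: "a = c *\<^sub>R u" "c\<^sup>2 = 1" using a[OF \<open>a \<in> A\<close>] by (simp_all add: c_def)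
    have "b = a" if "b \<in> A" for b
    proof (rule ccontr)
      assume "b \<noteq> a"
      then have "b \<bullet> a = 0"
        using pairwiseD[OF A(1) that \<open>a \<in> A\<close>] by (simp add: orthogonal_def)
      moreover have "c \<noteq> 0" using c by auto
      ultimately have "(u \<bullet> b)\<^sup>2 = 0" using c(1) by (simp add: inner_commute)
      then show False using a(2)[OF that] by simp
    qed
    then have "A = {a}" using \<open>a \<in> A\<close> by blast
    then have GX: "G \<bullet> X = g \<bullet> blinfun_of_hs X a" for X
      using has_sum_unique[OF sums[of X]] has_sum_finite[of "{a}" "\<lambda>a. blinfun_of_hs G a \<bullet> blinfun_of_hs X a"]
      by (simp add: g_def)
    have "blinfun_of_hs W a = 0" by (subst c(1)) (simp add: blinfun.scaleR_right Wu)
    then have "blinfun_of_hs H a = c *\<^sub>R v" by (simp add: H_apply c_def)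
    then have gv: "c * (g \<bullet> v) = norm g" using eq[OF \<open>a \<in> A\<close>] by (simp add: g_def)
    \<comment> \<open>Equality in Cauchy-Schwarz between \<open>g\<close> and the unit vector
      \<open>c *\<^sub>R v\<close>, expressed as zero distance.\<close>
    have "(norm (g - (norm g * c) *\<^sub>R v))\<^sup>2 = (norm g)\<^sup>2 - 2 * norm g * (c * (g \<bullet> v)) + (norm g)\<^sup>2 * c\<^sup>2"
      unfolding norm_diff_scaleR using v by (simp add: power_mult_distrib)
    also have "\<dots> = 0" unfolding gv c by (simp add: power2_eq_square)
    finally have g: "g = (norm g * c) *\<^sub>R v" by simp
    have "G \<bullet> X = (norm g *\<^sub>R (u \<otimes>\<^sub>H v)) \<bullet> X" for X
    proof -
      \<comment> \<open>The sign \<open>c\<close> occurs once from the right and once from the left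
        singular vector; it cancels, which makes the coefficient nonnegative.\<close>
      have "G \<bullet> X = (norm g * (c * c)) * (v \<bullet> blinfun_of_hs X u)"
        unfolding GX by (subst g) (simp add: c(1) blinfun.scaleR_right)
      also have "\<dots> = (norm g *\<^sub>R (u \<otimes>\<^sub>H v)) \<bullet> X"
        using c(2) by (simp add: power2_eq_square inner_commute[of _ X] inner_hs_tensor inner_commute[of v])
      finally show ?thesis .
    qed
    then have "G = norm g *\<^sub>R (u \<otimes>\<^sub>H v)" using vector_eq_rdot by blast
    then show ?thesis by (intro exI[of _ "norm g"]) simp
  qed
qed

end

text \<open>Here \<open>G\<^sup>* G\<close> is \<open>\<sigma>\<^sup>2\<close> times the projection
  onto \<open>span {u}\<close>, so \<open>\<sigma>\<close> is the only positive singular value, with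
  multiplicity one, and one summand survives.\<close>

lemma nuclear_norm_tensor:
  fixes u :: "'a::{real_inner,complete_space,second_countable_topology}"
    and v :: "'b::{real_inner,complete_space,second_countable_topology}"
  assumes "norm u = 1" "norm v = 1" "0 < \<sigma>"
  shows "nuclear_norm (\<sigma> *\<^sub>R (u \<otimes>\<^sub>H v)) = ennreal \<sigma>"
proof -
  let ?G = "\<sigma> *\<^sub>R (u \<otimes>\<^sub>H v)"
  have G: "blinfun_of_hs ?G x = (\<sigma> * (u \<bullet> x)) *\<^sub>R v" for x
    by (simp add: blinfun_of_hs_scaleR hs_tensor_apply)
  have adj: "adjoint (blinfun_of_hs ?G) = (\<lambda>y. (\<sigma> * (v \<bullet> y)) *\<^sub>R u)"
    by (rule adjoint_unique) (simp add: G inner_commute)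
  have E: "{x. adjoint (blinfun_of_hs ?G) (blinfun_of_hs ?G x) = s\<^sup>2 *\<^sub>R x} =
      {x. (\<sigma>\<^sup>2 * (u \<bullet> x)) *\<^sub>R u = s\<^sup>2 *\<^sub>R x}" for s
    using assms(2) by (simp add: adj G norm_eq_1 power2_eq_square mult_ac)
  have mult: "singular_multiplicity ?G s = (if s = \<sigma> then 1 else 0)" if "0 < s" for s
  proof (cases "s = \<sigma>")
    case True
    have "{x. (\<sigma>\<^sup>2 * (u \<bullet> x)) *\<^sub>R u = s\<^sup>2 *\<^sub>R x} = span {u}"
      using assms True by (auto simp: span_singleton norm_eq_1 simp flip: scaleR_scaleR) (metis rangeI)
    moreover have "independent {u}" using assms(1) by (intro independent_insertI) (auto simp: independent_empty)
    then have "dim (span {u}) = 1" using dim_span_eq_card_independent[of "{u}"] by simp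
    ultimately show ?thesis using True by (simp add: singular_multiplicity_def E)
  next
    case False
    have "x = 0" if "(\<sigma>\<^sup>2 * (u \<bullet> x)) *\<^sub>R u = s\<^sup>2 *\<^sub>R x" for x
    proof -
      \<comment> \<open>Pairing with \<open>u\<close> forces \<open>u \<bullet> x = 0\<close> when
        \<open>s\<close> differs from \<open>\<sigma>\<close>; the equation then reads
        \<open>s\<^sup>2 *\<^sub>R x = 0\<close>.\<close>
      have "u \<bullet> ((\<sigma>\<^sup>2 * (u \<bullet> x)) *\<^sub>R u) = u \<bullet> (s\<^sup>2 *\<^sub>R x)" using that by simp
      then have "\<sigma>\<^sup>2 * (u \<bullet> x) = s\<^sup>2 * (u \<bullet> x)" using assms(1) by (simp add: norm_eq_1)
      then have "u \<bullet> x = 0" using False \<open>0 < s\<close> assms(3) by (simp add: power2_eq_iff_nonneg)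
      then show ?thesis using that \<open>0 < s\<close> by simp
    qed
    then have "{x. (\<sigma>\<^sup>2 * (u \<bullet> x)) *\<^sub>R u = s\<^sup>2 *\<^sub>R x} = {0}" by auto
    moreover have "dim {0::'a} = 0"
      using dim_span_eq_card_independent[of "{}::'a set"] independent_empty by simp
    ultimately show ?thesis using False by (simp add: singular_multiplicity_def E)
  qed
  have "nuclear_norm ?G = (\<Sum>\<^sub>\<infinity>s\<in>{\<sigma>}. of_nat (singular_multiplicity ?G s) * ennreal s)"
    unfolding nuclear_norm_def by (rule infsum_cong_neutral) (use assms mult in auto)
  then show ?thesis using mult assms by simp
qed

text \<open>Gives real nuclear norms at every index for a competitor with finite objective, so that
  gaps can be formed by subtraction.\<close>

lemma sum_ennreal_finiteD:
  fixes f :: "'n::finite \<Rightarrow> ennreal"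
  assumes "sum f UNIV \<le> ennreal c"
  obtains t where "\<And>i. f i = ennreal (t i)" "\<And>i. 0 \<le> t i"
proof -
  have "f i \<noteq> top" for i
  proof -
    have "f i \<le> sum f UNIV" by (intro member_le_sum) auto
    then show ?thesis using assms ennreal_less_top[of c] by (metis leD order_trans)
  qed
  then have "f i = ennreal (enn2real (f i))" for i by (simp add: less_top)
  then show ?thesis by (intro that[of "\<lambda>i. enn2real (f i)"]) simp_all
qed

theorem proposition3p6:
  fixes u :: "'n::finite \<Rightarrow> 'a::{real_inner,complete_space,second_countable_topology}"
    and v :: "'n \<Rightarrow> 'b::{real_inner,complete_space,second_countable_topology}"
    and \<sigma> :: "'n \<Rightarrow> real"
    and \<Phi> :: "('a, 'b) hilbert_schmidt ^ 'n
                \<Rightarrow> 'c::{real_inner,complete_space,second_countable_topology}"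
    and F\<^sub>0 :: "('a, 'b) hilbert_schmidt ^ 'n"
    and z :: 'c
  assumes "\<And>i. norm (u i) = 1"
    and "\<And>i. norm (v i) = 1"
    and "\<And>i. \<sigma> i > 0"
    and "bounded_linear \<Phi>"
    and "F\<^sub>0 = (\<chi> i. \<sigma> i *\<^sub>R (u i \<otimes>\<^sub>H v i))"
    and "z = \<Phi> F\<^sub>0"
    and "NDSC \<Phi> u v"
    and "inj_on \<Phi> {F. \<forall>i. \<exists>\<alpha>\<ge>0. F $ i = \<alpha> *\<^sub>R (u i \<otimes>\<^sub>H v i)}"
  shows "{F. is_arg_min (\<lambda>F. \<Sum>i\<in>UNIV. nuclear_norm (F $ i)) (\<lambda>F. \<Phi> F = z) F} = {F\<^sub>0}"
proof -
  let ?S = "\<lambda>F :: ('a, 'b) hilbert_schmidt ^ 'n. \<Sum>i\<in>UNIV. nuclear_norm (F $ i)"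
  obtain y where "\<forall>i. \<exists>W. adjoint \<Phi> y $ i = u i \<otimes>\<^sub>H v i + W \<and> blinfun_of_hs W (u i) = 0 \<and>
      adjoint (blinfun_of_hs W) (v i) = 0 \<and> norm (blinfun_of_hs W) < 1"
    using assms(7) unfolding NDSC_def by auto
  then obtain W where W: "\<And>i. adjoint \<Phi> y $ i = u i \<otimes>\<^sub>H v i + W i \<and> blinfun_of_hs (W i) (u i) = 0 \<and>
      adjoint (blinfun_of_hs (W i)) (v i) = 0 \<and> norm (blinfun_of_hs (W i)) < 1"
    by metis
  have cert: "nuclear_certificate (u i) (v i) (W i)" for i
    using W[of i] assms(1,2) by unfold_locales auto
  define H where "H i = u i \<otimes>\<^sub>H v i + W i" for i
  have pairing: "(\<Sum>i\<in>UNIV. H i \<bullet> F $ i) = y \<bullet> \<Phi> F" for F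
    using inner_adjoint[OF assms(4), of F y] W by (simp add: inner_vec_def H_def inner_commute)
  have "H i \<bullet> F\<^sub>0 $ i = \<sigma> i" for i
    using nuclear_certificate.inner_H_tensor[OF cert, of i "\<sigma> i"] by (simp only: assms(5) H_def vec_lambda_beta)
  then have feasible: "(\<Sum>i\<in>UNIV. H i \<bullet> F $ i) = (\<Sum>i\<in>UNIV. \<sigma> i)" if "\<Phi> F = z" for F
    using that pairing[of F] pairing[of F\<^sub>0] assms(6) by simp
  have S0: "?S F\<^sub>0 = ennreal (\<Sum>i\<in>UNIV. \<sigma> i)"
    using assms(1-3) by (simp add: assms(5) nuclear_norm_tensor sum_ennreal less_imp_le)
  have optimal: "\<exists>t. (\<forall>i. nuclear_norm (F $ i) = ennreal (t i)) \<and> (\<forall>i. 0 \<le> t i) \<and>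
      (\<forall>i. H i \<bullet> F $ i = t i)" if F: "\<Phi> F = z" "?S F \<le> ?S F\<^sub>0" for F
  proof -
    obtain t where t: "\<And>i. nuclear_norm (F $ i) = ennreal (t i)" "\<And>i. 0 \<le> t i"
      using sum_ennreal_finiteD F(2) unfolding S0 by blast
    have le: "H i \<bullet> F $ i \<le> t i" for i
      using inner_le_nuclear_norm(1)[OF nuclear_certificate.norm_H_le[OF cert] t(1,2)] by (simp add: H_def)
    have "(\<Sum>i\<in>UNIV. t i) \<le> (\<Sum>i\<in>UNIV. \<sigma> i)"
      using F(2) assms(3) t by (simp add: S0 sum_ennreal sum_nonneg less_imp_le)
    \<comment> \<open>Only the totals over all indices are compared, but each gap is nonnegative, so
      a vanishing total gives equality at every index separately.\<close>
    then have "(\<Sum>i\<in>UNIV. t i - H i \<bullet> F $ i) = 0"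
      using sum_mono[of UNIV "\<lambda>i. H i \<bullet> F $ i" t] le feasible[OF F(1)]
      by (simp add: sum_subtractf)
    then have "\<forall>i\<in>UNIV. t i - H i \<bullet> F $ i = 0"
      using le by (subst (asm) sum_nonneg_eq_0_iff) auto
    then show ?thesis using t by (intro exI[of _ t]) auto
  qed
  have unique: "F = F\<^sub>0" if F: "\<Phi> F = z" "?S F \<le> ?S F\<^sub>0" for F
  proof -
    obtain t where t: "\<And>i. nuclear_norm (F $ i) = ennreal (t i)" "\<And>i. 0 \<le> t i"
      "\<And>i. H i \<bullet> F $ i = t i" using optimal[OF F] by blast
    have "\<exists>\<alpha>\<ge>0. F $ i = \<alpha> *\<^sub>R (u i \<otimes>\<^sub>H v i)" for i
      using nuclear_certificate.nuclear_norm_attained[OF cert t(1,2)] t(3)[of i] by (simp add: H_def)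
    moreover have "\<exists>\<alpha>\<ge>0. F\<^sub>0 $ i = \<alpha> *\<^sub>R (u i \<otimes>\<^sub>H v i)" for i
      using assms(3)[of i] by (auto simp: assms(5) intro!: exI[of _ "\<sigma> i"])
    ultimately show ?thesis using F(1) assms(6) by (intro inj_onD[OF assms(8)]) auto
  qed
  \<comment> \<open>Optimality is read off from uniqueness: a strictly better feasible
    \<open>F\<close> would have to be \<open>F\<^sub>0\<close> itself.\<close>
  have "\<not> ?S F < ?S F\<^sub>0" if "\<Phi> F = z" for F
    using unique[OF that] by (metis less_imp_le less_irrefl)
  then show ?thesis using unique assms(6) by (auto simp: is_arg_min_def linorder_not_less)
qed

end
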